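(* Let $X$ be a real-valued heavy-tailed random variable with $0<E(X)<\infty$, let $(X_i)_{i\ge1}$ be IID with the law of $X$, let $N$ be a heavy-tailed random variable with values in $\{1,2,3,\dots\}$ independent of $(X_i)$, and put $S_N=\sum_{k=1}^N X_k$. Suppose $E(N^{1+\delta})<\infty$ for some $\delta>0$, and let $h$ be a natural scale of the random variable $E(X)N$ such that $h(x)\ge(1+\delta)\log x$ for all sufficiently large $x$. If there is a natural scale $h_X$ of $X$ with $$\liminf_{x\to\infty}\frac{h_X(x)}{h(x)}\in[1,\infty],$$ then $h$ is a natural scale of $S_N$, i.e. $h\in\mathcal{I}(S_N)$.
   Context: For a random variable $Y$, the hazard function is $R_Y(x):=-\log P(Y>x)$. $Y$ is heavy-tailed if $E(e^{sY})=\infty$ for all $s>0$. For a heavy-tailed $Y$, a natural scale of $Y$ is a concave function $h:[0,\infty)\to[0,\infty)$ with $h(0)=0$, $h(x)\to\infty$ as $x\to\infty$, and $\liminf_{x\to\infty} R_Y(x)/h(x)=1$; $\mathcal{I}(Y)$ denotes the set of natural scales of $Y$. *)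

theory Defs
  imports "HOL-Probability.Probability"
begin

definition hazard :: "'a measure \<Rightarrow> ('a \<Rightarrow> real) \<Rightarrow> real \<Rightarrow> real" where
  "hazard M Y x = - ln (measure M {\<omega> \<in> space M. x < Y \<omega>})"

definition heavy_tailed :: "'a measure \<Rightarrow> ('a \<Rightarrow> real) \<Rightarrow> bool" where
  "heavy_tailed M Y \<longleftrightarrow>
     (\<forall>s>0. (\<integral>\<^sup>+ \<omega>. ennreal (exp (s * Y \<omega>)) \<partial>M) = \<infinity>)"

definition natural_scale :: "'a measure \<Rightarrow> ('a \<Rightarrow> real) \<Rightarrow> (real \<Rightarrow> real) \<Rightarrow> bool" where
  "natural_scale M Y h \<longleftrightarrow>
     heavy_tailed M Y \<and>
     concave_on {0..} h \<and> h 0 = 0 \<and> (\<forall>x\<ge>0. h x \<ge> 0) \<and>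
     filterlim h at_top at_top \<and>
     Liminf at_top (\<lambda>x. ereal (hazard M Y x / h x)) = 1"

end

theory Submission
  imports Defs
begin

text \<open>
  Write \<open>m = E(X)\<close>. The law of large numbers gives \<open>P(S_N > c x) \<ge> P(m N > x) / 2\<close> for
  \<open>c < 1\<close> and large \<open>x\<close>, so the tail of \<open>S_N\<close> is at least as heavy as \<open>h\<close> prescribes.
  For the converse let \<open>s < 1\<close> with \<open>s (1 + \<delta>) > 1\<close>, and let \<open>m' > m\<close>. The key fact is the
  one-step drift inequality \<open>E exp (s h(z + X)) \<le> exp (s h(z + m'))\<close> for large \<open>z\<close>; for the
  remaining \<open>z\<close> the left-hand side is bounded by a constant \<open>C\<close>. Iterating,
  \<open>E exp (s h(S_n)) \<le> exp (s h(n m')) + n C\<close>, and integrating over \<open>N\<close> gives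
  \<open>E exp (s h(S_N)) < \<infinity>\<close> as soon as \<open>s m' < m\<close>, because \<open>h(n m') \<le> (m' / m) h(n m)\<close>.
  Markov's inequality then yields \<open>P(S_N > x) = O(exp (- s h(x)))\<close>.
\<close>

section \<open>Concave scale functions: monotonicity, increments, supporting lines, exponential
  moments\<close>

locale concave_scale =
  fixes h :: "real \<Rightarrow> real"
  assumes concave: "concave_on {0..} h"
    and zero: "h 0 = 0"
    and nonneg: "\<And>x. 0 \<le> x \<Longrightarrow> 0 \<le> h x"
    and lim: "filterlim h at_top at_top"
begin

lemma concave_comb:
  assumes "0 \<le> x" "0 \<le> y" "0 \<le> t" "t \<le> 1"
  shows "(1 - t) * h x + t * h y \<le> h ((1 - t) * x + t * y)"
  using concave_onD[OF concave, of t x y] assms by simp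

text \<open>A nonnegative concave function on a half-line cannot decrease: \<open>y\<close> is a
  convex combination of \<open>x\<close> and a far point \<open>z\<close> of weight
  \<open>t\<close>. Dropping \<open>t * h z \<ge> 0\<close> and letting \<open>t\<close> tend to 0
  gives the claim.\<close>

lemma mono:
  assumes "0 \<le> x" "x \<le> y"
  shows "h x \<le> h y"
proof (cases "x = y")
  case False
  have bound: "(1 - t) * h x \<le> h y" if t: "0 < t" "t < 1" for t
  proof -
    define z where "z = x + (y - x) / t"
    have "(1 - t) * x + t * z = y"
      using t by (simp add: z_def field_simps)
    moreover have "0 \<le> z"
      using assms t by (simp add: z_def)
    ultimately have "(1 - t) * h x + t * h z \<le> h y"
      using concave_comb[of x z t] assms t by simp
    moreover have "0 \<le> t * h z"
      using t nonneg[OF \<open>0 \<le> z\<close>] by simp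
    ultimately show ?thesis by linarith
  qed
  have "((\<lambda>t. (1 - t) * h x) \<longlongrightarrow> (1 - 0) * h x) (at_right 0)"
    by (intro tendsto_intros)
  moreover have "\<forall>\<^sub>F t in at_right 0. (1 - t) * h x \<le> h y"
    by (rule eventually_at_rightI[of 0 1]) (auto intro: bound)
  ultimately show ?thesis
    using tendsto_upperbound[of _ "(1 - 0) * h x"] trivial_limit_at_right_real by fastforce
qed simp

text \<open>The points \<open>b\<close> and \<open>a + d\<close> are convex combinations of
  \<open>a\<close> and \<open>b + d\<close> with interchanged weights, so the two concavity
  inequalities add up to the claim.\<close>

lemma increment_antimono:
  assumes "0 \<le> a" "a \<le> b" "0 \<le> d"
  shows "h (b + d) - h b \<le> h (a + d) - h a"
proof (cases "b + d = a")
  case True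
  then have "b = a" "d = 0" using assms by auto
  then show ?thesis by simp
next
  case False
  define t where "t = (b - a) / (b + d - a)"
  have pos: "b + d - a > 0" using False assms by simp
  have t: "0 \<le> t" "t \<le> 1"
    using pos assms by (simp_all add: t_def)
  have teq: "t * (b + d - a) = b - a"
    using pos by (simp add: t_def)
  have "(1 - t) * a + t * (b + d) = a + t * (b + d - a)"
    by (simp add: algebra_simps)
  then have 1: "(1 - t) * a + t * (b + d) = b" using teq by simp
  have "(1 - t) * (b + d) + t * a = b + d - t * (b + d - a)"
    by (simp add: algebra_simps)
  then have 2: "(1 - t) * (b + d) + t * a = a + d" using teq by simp
  have "(1 - t) * h a + t * h (b + d) \<le> h b"
    using concave_comb[of a "b + d" t] t assms 1 by simp
  moreover have "(1 - t) * h (b + d) + t * h a \<le> h (a + d)"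
    using concave_comb[of "b + d" a t] t assms 2 by simp
  ultimately show ?thesis by (simp add: algebra_simps)
qed

lemma subadditive: "0 \<le> a \<Longrightarrow> 0 \<le> b \<Longrightarrow> h (a + b) \<le> h a + h b"
  using increment_antimono[of 0 a b] zero by simp

lemma scale_le:
  assumes "1 \<le> c" "0 \<le> x"
  shows "h (c * x) \<le> c * h x"
proof -
  have "(1 - 1 / c) * h 0 + 1 / c * h (c * x) \<le> h ((1 - 1 / c) * 0 + 1 / c * (c * x))"
    by (rule concave_comb) (use assms in auto)
  then show ?thesis using assms zero by (simp add: field_simps)
qed

lemma scale_ge:
  assumes "0 < c" "c \<le> 1" "0 \<le> x"
  shows "c * h x \<le> h (c * x)"
  using scale_le[of "1 / c" "c * x"] assms by (simp add: field_simps)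

text \<open>The slope \<open>b\<close> is the supremum of the difference quotients to the right of
  \<open>w\<close>. It is strictly positive because \<open>h\<close> is unbounded, so that
  \<open>1 / b\<close> can later serve as a truncation level.\<close>

lemma supergradient:
  assumes "0 < w"
  obtains b where "0 < b" "\<And>y. 0 \<le> y \<Longrightarrow> h y \<le> h w + b * (y - w)"
proof -
  define b where "b = - Inf ((\<lambda>t. (- h w - - h t) / (w - t)) ` ({w<..} \<inter> {0..}))"
  have "w \<in> interior {0..}"
    using assms by (simp add: interior_real_atLeast)
  then have le: "h y \<le> h w + b * (y - w)" if "0 \<le> y" for y
    using convex_le_Inf_differential[of "{0..}" "\<lambda>x. - h x" w y] concave that
    by (simp add: concave_on_def b_def)
  have "\<forall>\<^sub>F x in at_top. h w < h x \<and> w < x"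
    using lim by (auto intro: eventually_conj eventually_gt_at_top simp: filterlim_at_top_dense)
  then obtain x where x: "h w < h x" "w < x"
    using eventually_happens trivial_limit_at_top_linorder by blast
  have "0 < b * (x - w)" using le[of x] x assms by simp
  then have "0 < b" using x by (simp add: zero_less_mult_iff)
  with le show ?thesis by (rule that[rotated])
qed

text \<open>The endpoint is excluded because \<open>h\<close> may jump at 0.\<close>

lemma continuous: "continuous_on {0<..} h"
proof -
  have "convex_on {0<..} (\<lambda>x. - h x)"
    using concave unfolding concave_on_def by (rule convex_on_subset) auto
  then have "continuous_on {0<..} (\<lambda>x. - h x)"
    by (intro convex_on_continuous) auto
  then have "continuous_on {0<..} (\<lambda>x. - (- h x))"
    by (rule continuous_on_minus)
  then show ?thesis by simp
qed

text \<open>Nothing is known about \<open>h\<close> on negative arguments, hence the clipping at 0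
  in all exponential moments below. The clipped function is monotone and therefore Borel.\<close>

lemma borel_measurable_max [measurable]: "(\<lambda>x. h (max 0 x)) \<in> borel_measurable borel"
  by (rule borel_measurable_mono) (auto simp: mono_def intro!: mono)

lemma eventually_ge: "\<forall>\<^sub>F x in at_top. c \<le> h x"
  using lim by (simp add: filterlim_at_top)

text \<open>By continuity \<open>h\<close> takes every large integer value \<open>k\<close>, so the hypothesis yields
  \<open>P(h(Y) > k) \<le> exp (- (s' * k))\<close>, and the moment is dominated by a geometric series.\<close>

lemma nn_integral_exp_finite:
  assumes "prob_space M" and [measurable]: "Y \<in> borel_measurable M"
    and tail: "\<forall>\<^sub>F x in at_top. measure M {\<omega> \<in> space M. x < Y \<omega>} \<le> exp (- (s' * h x))"
    and s: "0 < s" "s < s'"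
  shows "(\<integral>\<^sup>+ \<omega>. ennreal (exp (s * h (max 0 (Y \<omega>)))) \<partial>M) < \<infinity>"
proof -
  interpret prob_space M by fact
  define Z where "Z \<omega> = h (max 0 (Y \<omega>))" for \<omega>
  have [measurable]: "Z \<in> borel_measurable M"
    unfolding Z_def by measurable
  obtain x0 where x0: "1 \<le> x0" "\<And>x. x0 \<le> x \<Longrightarrow> prob {\<omega> \<in> space M. x < Y \<omega>} \<le> exp (- (s' * h x))"
  proof -
    have "\<forall>\<^sub>F x in at_top. 1 \<le> x \<and> measure M {\<omega> \<in> space M. x < Y \<omega>} \<le> exp (- (s' * h x))"
      using tail eventually_ge_at_top by (rule eventually_conj[rotated])
    then show ?thesis using that unfolding eventually_at_top_linorder by blast
  qed
  \<comment> \<open>Counting levels from an integer above \<open>h x0\<close> makes each level be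
    attained at some \<open>y \<ge> x0\<close>, where the tail bound is available.\<close>
  define k0 where "k0 = nat \<lceil>h x0\<rceil>"
  have k0: "h x0 \<le> real k0" unfolding k0_def by linarith
  have tailZ: "prob {\<omega> \<in> space M. real (k + k0) < Z \<omega>} \<le> exp (- (s' * real (k + k0)))" for k
  proof -
    have "\<forall>\<^sub>F x in at_top. real (k + k0) \<le> h x \<and> x0 \<le> x"
      by (intro eventually_conj eventually_ge eventually_ge_at_top)
    then obtain x1 where x1: "real (k + k0) \<le> h x1" "x0 \<le> x1"
      using eventually_happens trivial_limit_at_top_linorder by blast
    have "\<exists>y\<ge>x0. y \<le> x1 \<and> h y = real (k + k0)"
    proof (rule IVT')
      show "continuous_on {x0..x1} h"
        using continuous by (rule continuous_on_subset) (use x0 in auto)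
    qed (use x1 k0 in auto)
    then obtain y where y: "x0 \<le> y" "h y = real (k + k0)" by blast
    have "{\<omega> \<in> space M. real (k + k0) < Z \<omega>} \<subseteq> {\<omega> \<in> space M. y < Y \<omega>}"
    proof safe
      fix \<omega> assume "real (k + k0) < Z \<omega>"
      then have "h y < h (max 0 (Y \<omega>))" by (simp add: Z_def y)
      then have "\<not> max 0 (Y \<omega>) \<le> y" using mono[of "max 0 (Y \<omega>)" y] by auto
      then show "y < Y \<omega>" using y x0 by auto
    qed
    then have "prob {\<omega> \<in> space M. real (k + k0) < Z \<omega>} \<le> prob {\<omega> \<in> space M. y < Y \<omega>}"
      by (intro finite_measure_mono) measurable
    also have "\<dots> \<le> exp (- (s' * real (k + k0)))"
      using x0(2)[OF y(1)] y by simp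
    finally show ?thesis .
  qed
  define q where "q = exp (s - s')"
  define c where "c = exp (s - (s' - s) * real k0)"
  have q: "0 < q" "q < 1" using s by (auto simp: q_def)
  have le_suminf: "f j \<le> (\<Sum>k. f k)" for f :: "nat \<Rightarrow> ennreal" and j
    using sum_le_suminf[of f "{j}"] by (simp add: summableI)
  \<comment> \<open>Above \<open>real k0 + 1\<close>, the value of \<open>Z\<close> lies in one
    interval from \<open>j + k0\<close> (excluded) to \<open>j + k0 + 1\<close> (included), and the
    single summand of index \<open>j\<close> already dominates.\<close>
  have pointwise: "ennreal (exp (s * Z \<omega>)) \<le> ennreal (exp (s * (real k0 + 1))) +
      (\<Sum>k. ennreal (exp (s * (real (k + k0) + 1))) * indicator {\<omega> \<in> space M. real (k + k0) < Z \<omega>} \<omega>)"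
    (is "_ \<le> _ + (\<Sum>k. ?f k)") if "\<omega> \<in> space M" for \<omega>
  proof (cases "Z \<omega> \<le> real k0 + 1")
    case True
    then have "exp (s * Z \<omega>) \<le> exp (s * (real k0 + 1))" using s by simp
    then show ?thesis by (meson add_increasing2 ennreal_leI zero_le)
  next
    case False
    define j where "j = nat (\<lceil>Z \<omega>\<rceil> - 1) - k0"
    have j: "real (j + k0) < Z \<omega>" "Z \<omega> \<le> real (j + k0) + 1"
      unfolding j_def using False by linarith+
    have "ennreal (exp (s * Z \<omega>)) \<le> ?f j"
      using j s that by (auto intro!: ennreal_leI)
    also have "\<dots> \<le> (\<Sum>k. ?f k)"
      by (rule le_suminf)
    finally show ?thesis by (simp add: add_increasing)
  qed
  have "(\<integral>\<^sup>+ \<omega>. ennreal (exp (s * Z \<omega>)) \<partial>M) \<le>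
     (\<integral>\<^sup>+ \<omega>. (ennreal (exp (s * (real k0 + 1))) +
      (\<Sum>k. ennreal (exp (s * (real (k + k0) + 1))) * indicator {\<omega> \<in> space M. real (k + k0) < Z \<omega>} \<omega>)) \<partial>M)"
    by (rule nn_integral_mono) (rule pointwise)
  also have "\<dots> = ennreal (exp (s * (real k0 + 1))) +
     (\<Sum>k. ennreal (exp (s * (real (k + k0) + 1))) * emeasure M {\<omega> \<in> space M. real (k + k0) < Z \<omega>})"
    by (subst nn_integral_add)
       (auto simp: nn_integral_suminf nn_integral_cmult emeasure_space_1)
  also have "\<dots> \<le> ennreal (exp (s * (real k0 + 1))) + (\<Sum>k. ennreal (c * q ^ k))"
  proof (intro add_left_mono suminf_le)
    fix k
    have "ennreal (exp (s * (real (k + k0) + 1))) * emeasure M {\<omega> \<in> space M. real (k + k0) < Z \<omega>}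
       = ennreal (exp (s * (real (k + k0) + 1)) * prob {\<omega> \<in> space M. real (k + k0) < Z \<omega>})"
      by (simp add: emeasure_eq_measure ennreal_mult)
    also have "\<dots> \<le> ennreal (exp (s * (real (k + k0) + 1)) * exp (- (s' * real (k + k0))))"
      by (intro ennreal_leI mult_left_mono tailZ) auto
    also have "exp (s * (real (k + k0) + 1)) * exp (- (s' * real (k + k0))) = c * q ^ k"
      unfolding c_def q_def exp_of_nat_mult[symmetric] exp_add[symmetric]
      by (simp add: algebra_simps)
    finally show "ennreal (exp (s * (real (k + k0) + 1))) * emeasure M {\<omega> \<in> space M. real (k + k0) < Z \<omega>}
       \<le> ennreal (c * q ^ k)" .
  qed auto
  also have "\<dots> < \<infinity>"
  proof -
    have "summable (\<lambda>k. c * q ^ k)" using q by (intro summable_mult summable_geometric) auto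
    then have "(\<Sum>k. ennreal (c * q ^ k)) \<noteq> \<infinity>"
      using q by (subst suminf_ennreal2) (auto simp: c_def)
    then show ?thesis by (simp add: less_top)
  qed
  finally show ?thesis by (simp add: Z_def)
qed

end

section \<open>The one-step drift inequality\<close>

lemma abs_exp_minus_one_le:
  fixes v :: real
  shows "\<bar>exp v - 1\<bar> \<le> \<bar>v\<bar> * exp (max 0 v)"
proof (cases "0 \<le> v")
  case True
  have "(1 + (- v)) * exp v \<le> exp (- v) * exp v"
    by (intro mult_right_mono exp_ge_add_one_self) simp
  then have "exp v - 1 \<le> v * exp v" by (simp add: exp_minus field_simps)
  then show ?thesis using True by simp
next
  case False
  then have "max 0 v = 0" "\<bar>exp v - 1\<bar> = 1 - exp v" "\<bar>v\<bar> = - v" by auto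
  moreover have "1 - exp v \<le> - v" using exp_ge_add_one_self[of v] by linarith
  ultimately show ?thesis by simp
qed

text \<open>This is a derivative at 0 in the variable \<open>1 / u\<close>, taken under the
  expectation. Clipping \<open>X\<close> at \<open>u\<close> keeps the exponent below
  \<open>s\<close>, so \<open>s * (\<bar>X\<bar> + c) * exp s\<close> dominates although
  \<open>X\<close> may have no exponential moment.\<close>

lemma (in prob_space) clipped_exp_moment_derivative:
  fixes X :: "'a \<Rightarrow> real"
  assumes X: "integrable M X" and "0 \<le> c" "0 < s"
  shows "((\<lambda>u. u * (expectation (\<lambda>\<omega>. exp (s / u * (min (X \<omega>) u - c))) - 1))
           \<longlongrightarrow> s * (expectation X - c)) at_top"
proof -
  have [measurable]: "X \<in> borel_measurable M" using X by simp
  define v where "v u x = s / u * (min x u - c)" for u x :: real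
  have v_le: "v u x \<le> s" if "0 < u" for u x
  proof -
    have "s / u * (min x u - c) \<le> s / u * u"
      using that assms by (intro mult_left_mono) auto
    then show ?thesis using that by (simp add: v_def)
  qed
  have bounded: "integrable M (\<lambda>\<omega>. exp (v u (X \<omega>)))" if "0 < u" for u
    using v_le[OF that] unfolding v_def
    by (intro integrable_const_bound[of _ "exp s"]) auto
  have "((\<lambda>u. expectation (\<lambda>\<omega>. u * (exp (v u (X \<omega>)) - 1))) \<longlongrightarrow>
      expectation (\<lambda>\<omega>. s * (X \<omega> - c))) at_top"
  proof (rule integral_dominated_convergence_at_top)
    show "(\<lambda>\<omega>. s * (X \<omega> - c)) \<in> borel_measurable M" by measurable
    show "(\<lambda>\<omega>. u * (exp (v u (X \<omega>)) - 1)) \<in> borel_measurable M" for u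
      unfolding v_def by measurable
    show "integrable M (\<lambda>\<omega>. s * (\<bar>X \<omega>\<bar> + c) * exp s)"
      using X by auto
    show "\<forall>\<^sub>F u in at_top. AE \<omega> in M. norm (u * (exp (v u (X \<omega>)) - 1)) \<le> s * (\<bar>X \<omega>\<bar> + c) * exp s"
      using eventually_gt_at_top[of 0]
    proof eventually_elim
      case (elim u)
      show ?case
      proof (rule AE_I2)
        fix \<omega>
        let ?x = "X \<omega>"
        have abs: "\<bar>v u ?x\<bar> = s / u * \<bar>min ?x u - c\<bar>"
          using elim assms by (simp add: v_def abs_mult)
        have "norm (u * (exp (v u ?x) - 1)) = u * \<bar>exp (v u ?x) - 1\<bar>"
          using elim by (simp add: abs_mult)
        also have "\<dots> \<le> u * (\<bar>v u ?x\<bar> * exp (max 0 (v u ?x)))"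
          using elim by (intro mult_left_mono abs_exp_minus_one_le) simp
        also have "\<dots> \<le> u * (\<bar>v u ?x\<bar> * exp s)"
          using elim assms v_le[OF elim, of ?x] by (intro mult_left_mono) auto
        also have "\<dots> = s * \<bar>min ?x u - c\<bar> * exp s"
          using elim by (simp add: abs)
        also have "\<dots> \<le> s * (\<bar>?x\<bar> + c) * exp s"
          using elim assms by (intro mult_left_mono mult_right_mono) auto
        finally show "norm (u * (exp (v u ?x) - 1)) \<le> s * (\<bar>?x\<bar> + c) * exp s" .
      qed
    qed
    show "AE \<omega> in M. ((\<lambda>u. u * (exp (v u (X \<omega>)) - 1)) \<longlongrightarrow> s * (X \<omega> - c)) at_top"
    proof (rule AE_I2)
      fix \<omega>
      have "((\<lambda>u. u * (exp (s / u * (X \<omega> - c)) - 1)) \<longlongrightarrow> s * (X \<omega> - c)) at_top"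
      proof -
        have "((\<lambda>y. exp (s * (X \<omega> - c) * y)) has_real_derivative s * (X \<omega> - c)) (at 0)"
          by (auto intro!: derivative_eq_intros)
        then have "((\<lambda>y. (exp (s * (X \<omega> - c) * y) - 1) / y) \<longlongrightarrow> s * (X \<omega> - c)) (at 0)"
          by (simp add: DERIV_def)
        then have "((\<lambda>y. (exp (s * (X \<omega> - c) * y) - 1) / y) \<longlongrightarrow> s * (X \<omega> - c)) (at_right 0)"
          by (rule tendsto_mono[rotated]) (simp add: at_le)
        then have "((\<lambda>u. (exp (s * (X \<omega> - c) * inverse u) - 1) / inverse u)
            \<longlongrightarrow> s * (X \<omega> - c)) at_top"
          by (rule filterlim_compose) (rule filterlim_inverse_at_right_top)
        then show ?thesis by (simp add: field_simps)
      qed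
      \<comment> \<open>For fixed \<omega> the clipping is inactive once \<open>u\<close> exceeds
        \<open>X \<omega>\<close>.\<close>
      moreover have "\<forall>\<^sub>F u in at_top. u * (exp (s / u * (X \<omega> - c)) - 1) = u * (exp (v u (X \<omega>)) - 1)"
        using eventually_ge_at_top[of "X \<omega>"] by eventually_elim (simp add: v_def min_absorb1)
      ultimately show "((\<lambda>u. u * (exp (v u (X \<omega>)) - 1)) \<longlongrightarrow> s * (X \<omega> - c)) at_top"
        by (rule Lim_transform_eventually)
    qed
  qed
  moreover have "expectation (\<lambda>\<omega>. s * (X \<omega> - c)) = s * (expectation X - c)"
    using X by (simp add: prob_space)
  moreover have "\<forall>\<^sub>F u in at_top. expectation (\<lambda>\<omega>. u * (exp (v u (X \<omega>)) - 1))
      = u * (expectation (\<lambda>\<omega>. exp (s / u * (min (X \<omega>) u - c))) - 1)"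
    using eventually_gt_at_top[of 0]
  proof eventually_elim
    case (elim u)
    show ?case using bounded[OF elim] by (simp add: v_def prob_space)
  qed
  ultimately show ?thesis
    using Lim_transform_eventually by fastforce
qed

text \<open>Put \<open>w = z + c\<close>, let \<open>b\<close> be a supergradient of \<open>h\<close> at \<open>w\<close> and \<open>u = 1 / b\<close>. On \<open>X \<le> u\<close> the
  tangent line bounds \<open>h(z + X)\<close>, and the negative drift gains a term of order \<open>b\<close>. On \<open>X > u\<close>
  concavity gives \<open>h(z + X) \<le> h(w) + 1 + h(X) - h(u)\<close>, which costs only
  \<open>O(exp (- s h(u))) = O(b powr (s (1 + \<delta>))) = o(b)\<close>.\<close>

lemma (in concave_scale) exp_moment_step:
  fixes X :: "'a \<Rightarrow> real"
  assumes "prob_space M" and X: "integrable M X"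
    and mean: "integral\<^sup>L M X < c" "0 \<le> c"
    and s: "0 < s" "1 < s * (1 + \<delta>)"
    and log: "\<forall>\<^sub>F x in at_top. (1 + \<delta>) * ln x \<le> h x"
    and sublinear: "\<And>a. 0 < a \<Longrightarrow> \<forall>\<^sub>F x in at_top. h x \<le> a * x"
    and fin: "(\<integral>\<^sup>+ \<omega>. ennreal (exp (s * h (max 0 (X \<omega>)))) \<partial>M) < \<infinity>"
  obtains z\<^sub>0 where "\<And>z. z\<^sub>0 \<le> z \<Longrightarrow>
    (\<integral>\<^sup>+ \<omega>. ennreal (exp (s * h (max 0 (z + X \<omega>)))) \<partial>M) \<le> ennreal (exp (s * h (z + c)))"
proof -
  interpret prob_space M by fact
  have [measurable]: "X \<in> borel_measurable M" using X by simp
  have intX: "integrable M (\<lambda>\<omega>. exp (s * h (max 0 (X \<omega>))))"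
    using fin by (intro integrableI_nonneg) auto
  define K where "K = expectation (\<lambda>\<omega>. exp (s * h (max 0 (X \<omega>))))"
  \<comment> \<open>Both are measured relative to \<open>exp (s * h w)\<close>: \<open>G\<close> is
    the tangent-line bound for jumps up to \<open>u\<close>, \<open>R\<close> the price of larger
    jumps. The factor \<open>exp s\<close> in \<open>R\<close> comes from
    \<open>h (w + u) \<le> h w + 1\<close>.\<close>
  define G where "G u x = exp (s / u * (min x u - c))" for u x
  define R where "R u = exp s * exp (- (s * h u))" for u
  have K: "0 \<le> K" unfolding K_def by (rule integral_nonneg_AE) simp
  have "((\<lambda>u. u * exp (- (s * h u))) \<longlongrightarrow> 0) at_top"
  proof (rule tendsto_sandwich)
    show "\<forall>\<^sub>F u in at_top. 0 \<le> u * exp (- (s * h u))"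
      using eventually_ge_at_top[of 0] by eventually_elim simp
    show "\<forall>\<^sub>F u in at_top. u * exp (- (s * h u)) \<le> u powr - (s * (1 + \<delta>) - 1)"
      using log eventually_gt_at_top[of 0]
    proof eventually_elim
      case (elim u)
      have "s * ((1 + \<delta>) * ln u) \<le> s * h u"
        using elim s by (intro mult_left_mono) auto
      then have "exp (ln u + - (s * h u)) \<le> exp (- (s * (1 + \<delta>) - 1) * ln u)"
        by (simp add: algebra_simps)
      moreover have "exp (ln u + - (s * h u)) = u * exp (- (s * h u))"
        using elim by (subst exp_add) simp
      ultimately show ?case using elim by (simp add: powr_def del: exp_le_cancel_iff)
    qed
    show "((\<lambda>u. u powr - (s * (1 + \<delta>) - 1)) \<longlongrightarrow> 0) at_top"
      using s by (intro tendsto_neg_powr filterlim_ident) auto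
  qed simp
  then have "((\<lambda>u. u * (expectation (\<lambda>\<omega>. G u (X \<omega>)) - 1) + exp s * (1 + K) * (u * exp (- (s * h u))))
      \<longlongrightarrow> s * (expectation X - c) + exp s * (1 + K) * 0) at_top"
    unfolding G_def by (intro tendsto_intros clipped_exp_moment_derivative X mean s)
  \<comment> \<open>After multiplication by \<open>u\<close>, the drift converges to a negative
    number while the cost of large jumps vanishes, so the sum is eventually negative.\<close>
  moreover have "s * (expectation X - c) + exp s * (1 + K) * 0 < 0"
    using s mean by (simp add: mult_pos_neg)
  ultimately have "\<forall>\<^sub>F u in at_top.
      u * (expectation (\<lambda>\<omega>. G u (X \<omega>)) - 1) + exp s * (1 + K) * (u * exp (- (s * h u))) < 0"
    by (rule order_tendstoD(2))
  then have "\<forall>\<^sub>F u in at_top. expectation (\<lambda>\<omega>. G u (X \<omega>)) + R u * (1 + K) \<le> 1 \<and> 1 \<le> u"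
    using eventually_ge_at_top[of 1]
  proof eventually_elim
    case (elim u)
    then have "u * (expectation (\<lambda>\<omega>. G u (X \<omega>)) + R u * (1 + K) - 1) < 0"
      by (simp add: R_def algebra_simps)
    then show ?case using elim by (simp add: mult_less_0_iff)
  qed
  then obtain U where U: "1 \<le> U"
      "\<And>u. U \<le> u \<Longrightarrow> expectation (\<lambda>\<omega>. G u (X \<omega>)) + R u * (1 + K) \<le> 1"
    unfolding eventually_at_top_linorder by blast
  have "\<forall>\<^sub>F z in at_top. h z \<le> 1 / U * z \<and> 1 \<le> z"
    using U by (intro eventually_conj sublinear eventually_ge_at_top) auto
  then obtain z\<^sub>0 where z0: "1 \<le> z\<^sub>0" "\<And>z. z\<^sub>0 \<le> z \<Longrightarrow> h z \<le> 1 / U * z"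
    unfolding eventually_at_top_linorder by blast
  show thesis
  proof (rule that)
    fix z assume z: "z\<^sub>0 \<le> z"
    define w where "w = z + c"
    have w: "z\<^sub>0 \<le> w" "0 < w" using z z0 mean by (auto simp: w_def)
    obtain b where b: "0 < b" "\<And>y. 0 \<le> y \<Longrightarrow> h y \<le> h w + b * (y - w)"
      using supergradient w by blast
    define u where "u = 1 / b"
    \<comment> \<open>The supporting line evaluated at 0 gives \<open>b * w \<le> h w\<close>.
      Sublinearity of \<open>h\<close> thus makes the slope at most \<open>1 / U\<close>, which
      places \<open>u\<close> in the range where the estimate for \<open>U\<close> applies.\<close>
    have "b * w \<le> 1 / U * w"
      using b(2)[of 0] zero z0(2)[OF w(1)] by (simp add: algebra_simps)
    then have "b \<le> 1 / U" using w by (meson mult_le_cancel_right_pos)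
    then have u: "U \<le> u" "0 < u" using b U by (auto simp: u_def field_simps)
    have b_eq: "b = 1 / u" by (simp add: u_def)
    have bu: "b * u = 1" using b by (simp add: u_def)
    have hu: "h u \<le> h w + 1"
      using b(2)[of u] u b w bu by (simp add: algebra_simps) (smt (verit) mult_pos_pos)
    have pointwise: "exp (s * h (max 0 (z + x)))
        \<le> exp (s * h w) * (G u x + R u * (1 + exp (s * h (max 0 x))))" (is "_ \<le> ?rhs") for x
    proof -
      have rhs: "?rhs = exp (s * h w) * G u x + exp (s * h w + s - s * h u)
          + exp (s * h w + s - s * h u + s * h (max 0 x))"
        by (simp add: R_def exp_add exp_diff exp_minus field_simps)
      have pos: "0 \<le> exp (s * h w) * G u x" by (simp add: G_def)
      consider "z + x < 0" | "0 \<le> z + x" "x \<le> u" | "0 \<le> z + x" "u < x" by linarith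
      then show ?thesis
      proof cases
        \<comment> \<open>Here the left-hand side is \<open>exp 0 = 1\<close>. The constant 1 next
          to \<open>exp (s * h (max 0 x))\<close> pays for it, since
          \<open>h u \<le> h w + 1\<close>.\<close>
        case 1
        have "s * h u \<le> s * (h w + 1)"
          using hu s by (intro mult_left_mono) auto
        then have "exp (s * h (max 0 (z + x))) \<le> exp (s * h w + s - s * h u)"
          using 1 by (simp add: zero algebra_simps)
        then show ?thesis unfolding rhs using pos by (smt (verit) exp_ge_zero)
      next
        case 2
        have "s * h (z + x) \<le> s * (h w + b * (x - c))"
          using b(2)[of "z + x"] 2 s by (intro mult_left_mono) (auto simp: w_def algebra_simps)
        then have "exp (s * h (z + x)) \<le> exp (s * h w + s / u * (x - c))"
          by (simp add: b_eq algebra_simps)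
        also have "\<dots> = exp (s * h w) * G u x"
          using 2 by (simp add: G_def exp_add min_absorb1)
        finally show ?thesis unfolding rhs using 2 by (smt (verit) exp_ge_zero)
      next
        case 3
        have "h (z + x) \<le> h (w + x)"
          using 3 mean by (intro mono) (auto simp: w_def)
        moreover have "h (w + x) - h (w + u) \<le> h x - h u"
          using increment_antimono[of u "w + u" "x - u"] 3 w u by simp
        moreover have "h (w + u) \<le> h w + 1"
          using b(2)[of "w + u"] w u bu by simp
        ultimately have "h (z + x) \<le> h w + 1 - h u + h x" by linarith
        then have "s * h (z + x) \<le> s * (h w + 1 - h u + h x)"
          using s by (intro mult_left_mono) auto
        then have "exp (s * h (max 0 (z + x))) \<le> exp (s * h w + s - s * h u + s * h (max 0 x))"
          using 3 u by (simp add: algebra_simps)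
        then show ?thesis unfolding rhs using pos by (smt (verit) exp_ge_zero)
      qed
    qed
    have intG: "integrable M (\<lambda>\<omega>. G u (X \<omega>))"
    proof (rule integrable_const_bound)
      have "s / u * (min x u - c) \<le> s / u * u" for x
        using u s mean by (intro mult_left_mono) auto
      then show "AE \<omega> in M. norm (G u (X \<omega>)) \<le> exp s"
        using u by (simp add: G_def)
    qed (simp add: G_def)
    have int: "integrable M (\<lambda>\<omega>. exp (s * h w) * (G u (X \<omega>) + R u * (1 + exp (s * h (max 0 (X \<omega>))))))"
      using intG intX by simp
    have "(\<integral>\<^sup>+ \<omega>. ennreal (exp (s * h (max 0 (z + X \<omega>)))) \<partial>M) \<le>
      (\<integral>\<^sup>+ \<omega>. ennreal (exp (s * h w) * (G u (X \<omega>) + R u * (1 + exp (s * h (max 0 (X \<omega>)))))) \<partial>M)"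
      by (intro nn_integral_mono ennreal_leI pointwise)
    also have "\<dots> = ennreal (expectation (\<lambda>\<omega>. exp (s * h w) * (G u (X \<omega>) + R u * (1 + exp (s * h (max 0 (X \<omega>)))))))"
      by (rule nn_integral_eq_integral[OF int]) (auto simp: G_def R_def intro!: mult_nonneg_nonneg add_nonneg_nonneg)
    also have "expectation (\<lambda>\<omega>. exp (s * h w) * (G u (X \<omega>) + R u * (1 + exp (s * h (max 0 (X \<omega>))))))
        = exp (s * h w) * (expectation (\<lambda>\<omega>. G u (X \<omega>)) + R u * (1 + K))"
      using intG intX by (simp add: K_def prob_space)
    also have "\<dots> \<le> exp (s * h w) * 1"
      by (intro mult_left_mono U u) simp
    finally show "(\<integral>\<^sup>+ \<omega>. ennreal (exp (s * h (max 0 (z + X \<omega>)))) \<partial>M) \<le> ennreal (exp (s * h (z + c)))"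
      by (simp add: w_def ennreal_leI)
  qed
qed

section \<open>Independence, random indices and the weak law of large numbers\<close>

context prob_space
begin

lemma indep_sets_reindex:
  assumes "inj_on f I" "indep_sets F (f ` I)"
  shows "indep_sets (\<lambda>i. F (f i)) I"
proof (rule indep_setsI)
  show "F (f i) \<subseteq> events" if "i \<in> I" for i
    using assms(2) that by (auto simp: indep_sets_def)
next
  fix A J assume J: "J \<noteq> {}" "J \<subseteq> I" "finite J" "\<forall>j\<in>J. A j \<in> F (f j)"
  have inj: "inj_on f J" using assms(1) J(2) by (rule inj_on_subset)
  define B where "B = A \<circ> the_inv_into J f"
  have B: "B (f j) = A j" if "j \<in> J" for j
    using the_inv_into_f_f[OF inj that] by (simp add: B_def)
  have "prob (\<Inter>i\<in>f ` J. B i) = (\<Prod>i\<in>f ` J. prob (B i))"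
    using J B by (intro indep_setsD[OF assms(2)]) auto
  then show "prob (\<Inter>j\<in>J. A j) = (\<Prod>j\<in>J. prob (A j))"
    using B by (simp add: prod.reindex[OF inj])
qed

text \<open>This strips the constructor \<open>Some\<close> from the index set of the joint
  independence hypothesis.\<close>

lemma indep_vars_reindex:
  assumes "inj_on f I" "indep_vars (\<lambda>_. N) X (f ` I)"
  shows "indep_vars (\<lambda>_. N) (\<lambda>i. X (f i)) I"
  using assms indep_sets_reindex[OF assms(1), of "\<lambda>i. {X i -` A \<inter> space M |A. A \<in> sets N}"]
  by (auto simp: indep_vars_def2)

text \<open>Tonelli's theorem for the joint law, which is the product of the marginal laws.\<close>

lemma nn_integral_indep_var:
  assumes "indep_var S U T V" and f: "f \<in> borel_measurable (S \<Otimes>\<^sub>M T)"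
  shows "(\<integral>\<^sup>+ \<omega>. f (U \<omega>, V \<omega>) \<partial>M) = (\<integral>\<^sup>+ \<omega>. (\<integral>\<^sup>+ \<omega>'. f (U \<omega>, V \<omega>') \<partial>M) \<partial>M)"
proof -
  have [measurable]: "random_variable S U" "random_variable T V"
    and eq: "distr M S U \<Otimes>\<^sub>M distr M T V = distr M (S \<Otimes>\<^sub>M T) (\<lambda>x. (U x, V x))"
    using assms(1) by (auto simp: indep_var_distribution_eq)
  note f[measurable]
  interpret V: prob_space "distr M T V" by (rule prob_space_distr) fact
  have "(\<integral>\<^sup>+ \<omega>. f (U \<omega>, V \<omega>) \<partial>M) = (\<integral>\<^sup>+ p. f p \<partial>(distr M S U \<Otimes>\<^sub>M distr M T V))"
    unfolding eq by (subst nn_integral_distr) auto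
  also have "\<dots> = (\<integral>\<^sup>+ x. (\<integral>\<^sup>+ y. f (x, y) \<partial>distr M T V) \<partial>distr M S U)"
    by (rule V.nn_integral_fst[symmetric]) simp
  also have "\<dots> = (\<integral>\<^sup>+ x. (\<integral>\<^sup>+ \<omega>'. f (x, V \<omega>') \<partial>M) \<partial>distr M S U)"
    by (intro nn_integral_cong nn_integral_distr) (auto simp: measurable_compose[OF measurable_Pair1' f])
  also have "\<dots> = (\<integral>\<^sup>+ \<omega>. (\<integral>\<^sup>+ \<omega>'. f (U \<omega>, V \<omega>') \<partial>M) \<partial>M)"
    by (rule nn_integral_distr) auto
  finally show ?thesis .
qed

text \<open>On the event \<open>N = n\<close> the random index can be replaced by \<open>n\<close>.
  Summing over these events, independence of \<open>N\<close> from each single \<open>S n\<close>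
  suffices.\<close>

lemma nn_integral_random_index:
  fixes N :: "'a \<Rightarrow> nat" and S :: "nat \<Rightarrow> 'a \<Rightarrow> real" and g :: "nat \<Rightarrow> real \<Rightarrow> ennreal"
  assumes N [measurable]: "N \<in> measurable M (count_space UNIV)"
    and indep: "\<And>n. indep_var borel (\<lambda>\<omega>. real (N \<omega>)) borel (S n)"
    and g [measurable]: "\<And>n. g n \<in> borel_measurable borel"
  shows "(\<integral>\<^sup>+ \<omega>. g (N \<omega>) (S (N \<omega>) \<omega>) \<partial>M) = (\<integral>\<^sup>+ \<omega>. (\<integral>\<^sup>+ \<omega>'. g (N \<omega>) (S (N \<omega>) \<omega>') \<partial>M) \<partial>M)"
proof -
  have [measurable]: "S n \<in> borel_measurable M" for n
    using indep indep_var_rv2 by blast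
  have pick: "F k = (\<Sum>n. F n * indicator {real n} (real k))" for F :: "nat \<Rightarrow> ennreal" and k
    by (subst suminf_finite[of "{k}"]) auto
  have "(\<integral>\<^sup>+ \<omega>. g (N \<omega>) (S (N \<omega>) \<omega>) \<partial>M) =
      (\<integral>\<^sup>+ \<omega>. (\<Sum>n. g n (S n \<omega>) * indicator {real n} (real (N \<omega>))) \<partial>M)"
    by (rule nn_integral_cong) (rule pick)
  also have "\<dots> = (\<Sum>n. \<integral>\<^sup>+ \<omega>. g n (S n \<omega>) * indicator {real n} (real (N \<omega>)) \<partial>M)"
    by (rule nn_integral_suminf) measurable
  also have "\<dots> = (\<Sum>n. \<integral>\<^sup>+ \<omega>. (\<integral>\<^sup>+ \<omega>'. g n (S n \<omega>') * indicator {real n} (real (N \<omega>)) \<partial>M) \<partial>M)"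
  proof (rule suminf_cong)
    fix n
    show "(\<integral>\<^sup>+ \<omega>. g n (S n \<omega>) * indicator {real n} (real (N \<omega>)) \<partial>M) =
       (\<integral>\<^sup>+ \<omega>. (\<integral>\<^sup>+ \<omega>'. g n (S n \<omega>') * indicator {real n} (real (N \<omega>)) \<partial>M) \<partial>M)"
      using nn_integral_indep_var[OF indep[of n],
          of "\<lambda>p. g n (snd p) * indicator {real n} (fst p)"] by simp
  qed
  also have "\<dots> = (\<Sum>n. \<integral>\<^sup>+ \<omega>. (\<integral>\<^sup>+ \<omega>'. g n (S n \<omega>') \<partial>M) * indicator {real n} (real (N \<omega>)) \<partial>M)"
    by (simp add: nn_integral_multc)
  also have "\<dots> = (\<integral>\<^sup>+ \<omega>. (\<Sum>n. (\<integral>\<^sup>+ \<omega>'. g n (S n \<omega>') \<partial>M) * indicator {real n} (real (N \<omega>))) \<partial>M)"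
    by (rule nn_integral_suminf[symmetric]) measurable
  also have "\<dots> = (\<integral>\<^sup>+ \<omega>. (\<integral>\<^sup>+ \<omega>'. g (N \<omega>) (S (N \<omega>) \<omega>') \<partial>M) \<partial>M)"
    by (rule nn_integral_cong) (rule pick[symmetric])
  finally show ?thesis .
qed

text \<open>A one-sided weak law under a first moment. \<open>X\<close> is at least its truncation
  \<open>Y\<close> to \<open>[- K, K]\<close> minus the excess \<open>D\<close> below
  \<open>- K\<close>. Hoeffding's inequality controls the sum of the \<open>Y i\<close>, and
  Markov's inequality that of the \<open>D i\<close>.\<close>

lemma eventually_prob_sum_gt:
  fixes X :: "nat \<Rightarrow> 'a \<Rightarrow> real"
  assumes indep: "indep_vars (\<lambda>_. borel) X {1..}"
    and ident: "\<And>i. 1 \<le> i \<Longrightarrow> distr M borel (X i) = distr M borel (X 1)"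
    and int: "integrable M (X 1)" and a: "a < expectation (X 1)"
  shows "\<forall>\<^sub>F n in sequentially. 1 / 2 \<le> prob {\<omega> \<in> space M. a * real n < (\<Sum>k\<in>{1..n}. X k \<omega>)}"
proof -
  have X [measurable]: "X i \<in> borel_measurable M" if "1 \<le> i" for i
    using indep that by (auto simp: indep_vars_def)
  \<comment> \<open>The gap is split into three parts: the loss of mean by truncation, the Hoeffding
    deviation, and the sum of the excesses.\<close>
  define e where "e = (expectation (X 1) - a) / 3"
  have e: "0 < e" using a by (simp add: e_def)
  have "((\<lambda>K. expectation (\<lambda>\<omega>. max (- K) (min (X 1 \<omega>) K))) \<longlongrightarrow> expectation (X 1)) at_top"
  proof (rule integral_dominated_convergence_at_top)
    show "integrable M (\<lambda>\<omega>. \<bar>X 1 \<omega>\<bar>)" using int by simp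
    show "\<forall>\<^sub>F K in at_top. AE \<omega> in M. norm (max (- K) (min (X 1 \<omega>) K)) \<le> \<bar>X 1 \<omega>\<bar>"
      using eventually_ge_at_top[of 0] by eventually_elim auto
    show "AE \<omega> in M. ((\<lambda>K. max (- K) (min (X 1 \<omega>) K)) \<longlongrightarrow> X 1 \<omega>) at_top"
    proof (rule AE_I2)
      fix \<omega>
      have "\<forall>\<^sub>F K in at_top. X 1 \<omega> = max (- K) (min (X 1 \<omega>) K)"
        using eventually_ge_at_top[of "\<bar>X 1 \<omega>\<bar>"] by eventually_elim auto
      then show "((\<lambda>K. max (- K) (min (X 1 \<omega>) K)) \<longlongrightarrow> X 1 \<omega>) at_top"
        by (rule Lim_transform_eventually[OF tendsto_const])
    qed
  qed measurable
  moreover have "((\<lambda>K. expectation (\<lambda>\<omega>. max 0 (- K - X 1 \<omega>))) \<longlongrightarrow> expectation (\<lambda>\<omega>. 0)) at_top"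
  proof (rule integral_dominated_convergence_at_top)
    show "integrable M (\<lambda>\<omega>. \<bar>X 1 \<omega>\<bar>)" using int by simp
    show "\<forall>\<^sub>F K in at_top. AE \<omega> in M. norm (max 0 (- K - X 1 \<omega>)) \<le> \<bar>X 1 \<omega>\<bar>"
      using eventually_ge_at_top[of 0] by eventually_elim auto
    show "AE \<omega> in M. ((\<lambda>K. max 0 (- K - X 1 \<omega>)) \<longlongrightarrow> 0) at_top"
    proof (rule AE_I2)
      fix \<omega>
      have "\<forall>\<^sub>F K in at_top. 0 = max 0 (- K - X 1 \<omega>)"
        using eventually_ge_at_top[of "\<bar>X 1 \<omega>\<bar>"] by eventually_elim auto
      then show "((\<lambda>K. max 0 (- K - X 1 \<omega>)) \<longlongrightarrow> 0) at_top"
        by (rule Lim_transform_eventually[OF tendsto_const])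
    qed
  qed measurable
  ultimately have "\<forall>\<^sub>F K in at_top. expectation (X 1) - e < expectation (\<lambda>\<omega>. max (- K) (min (X 1 \<omega>) K))
      \<and> expectation (\<lambda>\<omega>. max 0 (- K - X 1 \<omega>)) < e / 4 \<and> 0 < K"
    using e by (intro eventually_conj eventually_gt_at_top order_tendstoD) auto
  \<comment> \<open>The bound \<open>e / 4\<close> on the mean excess makes the Markov bound at
    level \<open>e * real n\<close> equal to \<open>1 / 4\<close>; with another \<open>1 / 4\<close>
    from Hoeffding the failure probability is at most \<open>1 / 2\<close>.\<close>
  then obtain K where K: "0 < K" "expectation (X 1) - e < expectation (\<lambda>\<omega>. max (- K) (min (X 1 \<omega>) K))"
    "expectation (\<lambda>\<omega>. max 0 (- K - X 1 \<omega>)) < e / 4"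
    using eventually_happens trivial_limit_at_top_linorder by blast
  define Y where "Y i \<omega> = max (- K) (min (X i \<omega>) K)" for i \<omega>
  define D where "D i \<omega> = max 0 (- K - X i \<omega>)" for i \<omega>
  have transfer: "integrable M (\<lambda>\<omega>. f (X i \<omega>)) \<longleftrightarrow> integrable M (\<lambda>\<omega>. f (X 1 \<omega>))"
    "expectation (\<lambda>\<omega>. f (X i \<omega>)) = expectation (\<lambda>\<omega>. f (X 1 \<omega>))"
    if "1 \<le> i" and [measurable]: "f \<in> borel_measurable borel" for i and f :: "real \<Rightarrow> real"
    using that ident[OF that(1)] integrable_distr_eq[of "X i" M borel f] integrable_distr_eq[of "X 1" M borel f]
      integral_distr[of "X i" M borel f] integral_distr[of "X 1" M borel f] by auto
  have D_int: "integrable M (D i)" "expectation (D i) < e / 4" if "1 \<le> i" for i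
    using transfer[OF that, of "\<lambda>x. max 0 (- K - x)"] K int unfolding D_def by auto
  have D_nonneg: "0 \<le> D i \<omega>" for i \<omega> by (simp add: D_def)
  have hoeffding: "prob {\<omega> \<in> space M. (\<Sum>k\<in>{1..n}. Y k \<omega>) \<le> real n * expectation (Y 1) - e * real n}
      \<le> exp (- (e\<^sup>2 / (2 * K\<^sup>2)) * real n)" if n: "1 \<le> n" for n
  proof -
    interpret Hoeffding_ineq_iid M "{1..n}" Y "Y 1" "- K" K "expectation (Y 1)"
    proof unfold_locales
      have "indep_vars (\<lambda>_. borel) X {1..n}"
        using indep by (rule indep_vars_subset) auto
      then show "indep_vars (\<lambda>_. borel) Y {1..n}"
        unfolding Y_def by (rule indep_vars_compose2) measurable
      show "distr M borel (Y i) = distr M borel (Y 1)" if "i \<in> {1..n}" for i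
      proof -
        have "distr M borel (Y j) = distr (distr M borel (X j)) borel (\<lambda>x. max (- K) (min x K))"
          if "1 \<le> j" for j
          using that by (simp add: distr_distr comp_def Y_def[abs_def])
        note distr_Y = this
        have "distr M borel (Y i) = distr (distr M borel (X i)) borel (\<lambda>x. max (- K) (min x K))"
          using that by (intro distr_Y) simp
        also have "distr M borel (X i) = distr M borel (X 1)"
          using that by (intro ident) simp
        also have "distr (distr M borel (X 1)) borel (\<lambda>x. max (- K) (min x K)) = distr M borel (Y 1)"
          by (rule distr_Y[symmetric]) simp
        finally show ?thesis .
      qed
      show "random_variable borel (Y 1)" unfolding Y_def by measurable
      show "AE \<omega> in M. Y 1 \<omega> \<in> {- K..K}" using K by (auto simp: Y_def)
    qed auto
    have "prob {\<omega> \<in> space M. (\<Sum>k\<in>{1..n}. Y k \<omega>) \<le> real n * expectation (Y 1) - e * real n}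
        \<le> exp (- 2 * (e * real n)\<^sup>2 / (real n * (K - - K)\<^sup>2))"
      using Hoeffding_ineq_le[of "e * real n"] K e n by (simp del: expectation_X)
    also have "- 2 * (e * real n)\<^sup>2 / (real n * (K - - K)\<^sup>2) = - (e\<^sup>2 / (2 * K\<^sup>2)) * real n"
      using n K by (simp add: power2_eq_square field_simps)
    finally show ?thesis .
  qed
  have "((\<lambda>n. exp (- (e\<^sup>2 / (2 * K\<^sup>2)) * real n)) \<longlongrightarrow> 0) sequentially"
    using e K by real_asymp
  then have "\<forall>\<^sub>F n in sequentially. exp (- (e\<^sup>2 / (2 * K\<^sup>2)) * real n) < 1 / 4"
    by (rule order_tendstoD) simp
  then show ?thesis
    using eventually_ge_at_top[of 1]
  proof eventually_elim
    case (elim n)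
    let ?S = "{\<omega> \<in> space M. (\<Sum>k\<in>{1..n}. X k \<omega>) \<le> a * real n}"
    let ?A = "{\<omega> \<in> space M. (\<Sum>k\<in>{1..n}. Y k \<omega>) \<le> real n * expectation (Y 1) - e * real n}"
    let ?B = "{\<omega> \<in> space M. e * real n \<le> (\<Sum>k\<in>{1..n}. D k \<omega>)}"
    have [measurable]: "(\<lambda>\<omega>. \<Sum>k\<in>{1..n}. X k \<omega>) \<in> borel_measurable M"
      "(\<lambda>\<omega>. \<Sum>k\<in>{1..n}. Y k \<omega>) \<in> borel_measurable M"
      "(\<lambda>\<omega>. \<Sum>k\<in>{1..n}. D k \<omega>) \<in> borel_measurable M"
      unfolding Y_def D_def using X by auto
    have "?S \<subseteq> ?A \<union> ?B"
    proof (rule subsetI, rule ccontr)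
      fix \<omega> assume \<omega>: "\<omega> \<in> ?S" "\<omega> \<notin> ?A \<union> ?B"
      have "(\<Sum>k\<in>{1..n}. Y k \<omega>) - (\<Sum>k\<in>{1..n}. D k \<omega>) \<le> (\<Sum>k\<in>{1..n}. X k \<omega>)"
        unfolding sum_subtractf[symmetric] using K by (intro sum_mono) (auto simp: Y_def D_def)
      moreover have "real n * (expectation (X 1) - e) \<le> real n * expectation (Y 1)"
        using K by (intro mult_left_mono) (auto simp: Y_def[abs_def])
      moreover have "real n * (expectation (X 1) - e) - 2 * (e * real n) = a * real n"
        by (simp add: e_def field_simps)
      ultimately show False using \<omega> by simp
    qed
    then have "prob ?S \<le> prob (?A \<union> ?B)" by (intro finite_measure_mono) measurable
    also have "\<dots> \<le> prob ?A + prob ?B" by (intro measure_Un_le) measurable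
    also have "prob ?A \<le> 1 / 4" using hoeffding[of n] elim by simp
    also have "prob ?B \<le> expectation (\<lambda>\<omega>. \<Sum>k\<in>{1..n}. D k \<omega>) / (e * real n)"
      using D_int elim e
      by (intro integral_Markov_inequality_measure[where A = "{}"]) (auto intro!: sum_nonneg D_nonneg)
    also have "\<dots> \<le> real n * (e / 4) / (e * real n)"
    proof (rule divide_right_mono)
      have "expectation (\<lambda>\<omega>. \<Sum>k\<in>{1..n}. D k \<omega>) = (\<Sum>k\<in>{1..n}. expectation (D k))"
        using D_int by (intro Bochner_Integration.integral_sum) auto
      also have "\<dots> \<le> real (card {1..n}) * (e / 4)"
        by (intro sum_bounded_above) (use D_int in force)
      finally show "expectation (\<lambda>\<omega>. \<Sum>k\<in>{1..n}. D k \<omega>) \<le> real n * (e / 4)" by simp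
    qed (use e in simp)
    also have "\<dots> = 1 / 4" using e elim by simp
    finally have "prob ?S \<le> 1 / 2" by simp
    moreover have "{\<omega> \<in> space M. a * real n < (\<Sum>k\<in>{1..n}. X k \<omega>)} = space M - ?S" by auto
    moreover have "prob (space M - ?S) = 1 - prob ?S" by (intro prob_compl) measurable
    ultimately show ?case by simp
  qed
qed

end

section \<open>Exponential moments along the random walk\<close>

text \<open>Integrating out the last summand replaces it by \<open>c\<close> at the cost of an
  additive \<open>C\<close>. The shift \<open>c\<close> is absorbed into the starting point, which
  is why the induction is over all \<open>a \<ge> 0\<close>.\<close>

lemma (in concave_scale) random_walk_exp_moment:
  fixes X :: "nat \<Rightarrow> 'a \<Rightarrow> real"
  assumes "prob_space M" and X: "integrable M (X 1)"
    and ident: "\<And>i. 1 \<le> i \<Longrightarrow> distr M borel (X i) = distr M borel (X 1)"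
    and indep: "\<And>n. prob_space.indep_var M borel (\<lambda>\<omega>. \<Sum>k\<in>{1..n}. X k \<omega>) borel (X (Suc n))"
    and mean: "integral\<^sup>L M (X 1) < c" "0 \<le> c"
    and s: "0 < s" "1 < s * (1 + \<delta>)"
    and log: "\<forall>\<^sub>F x in at_top. (1 + \<delta>) * ln x \<le> h x"
    and sublinear: "\<And>a. 0 < a \<Longrightarrow> \<forall>\<^sub>F x in at_top. h x \<le> a * x"
    and fin: "(\<integral>\<^sup>+ \<omega>. ennreal (exp (s * h (max 0 (X 1 \<omega>)))) \<partial>M) < \<infinity>"
  obtains C where "0 \<le> C" "\<And>n a. 0 \<le> a \<Longrightarrow>
    (\<integral>\<^sup>+ \<omega>. ennreal (exp (s * h (max 0 (a + (\<Sum>k\<in>{1..n}. X k \<omega>))))) \<partial>M)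
      \<le> ennreal (exp (s * h (a + real n * c)) + real n * C)"
proof -
  interpret prob_space M by fact
  obtain z1 where z1: "\<And>z. z1 \<le> z \<Longrightarrow>
    (\<integral>\<^sup>+ \<omega>. ennreal (exp (s * h (max 0 (z + X 1 \<omega>)))) \<partial>M) \<le> ennreal (exp (s * h (z + c)))"
    using exp_moment_step[OF \<open>prob_space M\<close> X mean s log sublinear fin] by blast
  define z0 where "z0 = max 0 z1"
  have [measurable]: "X 1 \<in> borel_measurable M" using X by simp
  define K where "K = enn2real (\<integral>\<^sup>+ \<omega>. ennreal (exp (s * h (max 0 (X 1 \<omega>)))) \<partial>M)"
  have K: "(\<integral>\<^sup>+ \<omega>. ennreal (exp (s * h (max 0 (X 1 \<omega>)))) \<partial>M) = ennreal K" "0 \<le> K"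
    using fin by (simp_all add: K_def)
  define C where "C = exp (s * h z0) * K"
  have C: "0 \<le> C" using K by (simp add: C_def)
  \<comment> \<open>The drift inequality covers \<open>z \<ge> z0\<close>. For smaller
    \<open>z\<close>, including negative ones, monotonicity and subadditivity bound the moment by
    the constant \<open>C\<close>.\<close>
  have step: "(\<integral>\<^sup>+ \<omega>. ennreal (exp (s * h (max 0 (z + X 1 \<omega>)))) \<partial>M)
      \<le> ennreal (exp (s * h (max 0 (z + c)))) + ennreal C" for z
  proof (cases "z0 \<le> z")
    case True
    then show ?thesis using z1[of z] mean by (simp add: z0_def add_increasing2)
  next
    case False
    have "exp (s * h (max 0 (z + x))) \<le> exp (s * h z0) * exp (s * h (max 0 x))" for x
    proof -
      have "h (max 0 (z + x)) \<le> h (z0 + max 0 x)"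
        using False by (intro mono) (auto simp: z0_def)
      also have "\<dots> \<le> h z0 + h (max 0 x)"
        by (rule subadditive) (auto simp: z0_def)
      finally have "s * h (max 0 (z + x)) \<le> s * (h z0 + h (max 0 x))"
        using s by (intro mult_left_mono) auto
      then show ?thesis by (simp add: exp_add[symmetric] algebra_simps)
    qed
    then have "(\<integral>\<^sup>+ \<omega>. ennreal (exp (s * h (max 0 (z + X 1 \<omega>)))) \<partial>M)
        \<le> (\<integral>\<^sup>+ \<omega>. ennreal (exp (s * h z0)) * ennreal (exp (s * h (max 0 (X 1 \<omega>)))) \<partial>M)"
      by (intro nn_integral_mono) (simp add: ennreal_mult[symmetric] ennreal_leI)
    also have "\<dots> = ennreal C"
      using K by (subst nn_integral_cmult) (simp_all add: C_def ennreal_mult del: One_nat_def)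
    finally show ?thesis by (simp add: add_increasing)
  qed
  have bound: "(\<integral>\<^sup>+ \<omega>. ennreal (exp (s * h (max 0 (a + (\<Sum>k\<in>{1..n}. X k \<omega>))))) \<partial>M)
      \<le> ennreal (exp (s * h (a + real n * c)) + real n * C)" if "0 \<le> a" for n a
    using that
  proof (induction n arbitrary: a)
    case 0
    then show ?case by (simp add: emeasure_space_1)
  next
    case (Suc n)
    let ?S = "\<lambda>\<omega>. \<Sum>k\<in>{1..n}. X k \<omega>"
    have [measurable]: "?S \<in> borel_measurable M" "X (Suc n) \<in> borel_measurable M"
      using indep indep_var_rv1 indep_var_rv2 by blast+
    have "(\<integral>\<^sup>+ \<omega>. ennreal (exp (s * h (max 0 (a + (\<Sum>k\<in>{1..Suc n}. X k \<omega>))))) \<partial>M)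
      = (\<integral>\<^sup>+ \<omega>. ennreal (exp (s * h (max 0 (a + ?S \<omega> + X (Suc n) \<omega>)))) \<partial>M)"
      by (simp add: add.assoc)
    also have "\<dots> = (\<integral>\<^sup>+ \<omega>. (\<integral>\<^sup>+ \<omega>'. ennreal (exp (s * h (max 0 (a + ?S \<omega> + X (Suc n) \<omega>')))) \<partial>M) \<partial>M)"
      using nn_integral_indep_var[OF indep[of n],
          of "\<lambda>p. ennreal (exp (s * h (max 0 (a + fst p + snd p))))"] by simp
    also have "\<dots> = (\<integral>\<^sup>+ \<omega>. (\<integral>\<^sup>+ \<omega>'. ennreal (exp (s * h (max 0 (a + ?S \<omega> + X 1 \<omega>')))) \<partial>M) \<partial>M)"
    proof (rule nn_integral_cong)
      fix \<omega>
      have "(\<integral>\<^sup>+ \<omega>'. f (X (Suc n) \<omega>') \<partial>M) = (\<integral>\<^sup>+ \<omega>'. f (X 1 \<omega>') \<partial>M)"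
        if "f \<in> borel_measurable borel" for f
        using that ident[of "Suc n"] nn_integral_distr[of "X (Suc n)" M borel f]
          nn_integral_distr[of "X 1" M borel f] by (simp del: One_nat_def)
      then show "(\<integral>\<^sup>+ \<omega>'. ennreal (exp (s * h (max 0 (a + ?S \<omega> + X (Suc n) \<omega>')))) \<partial>M)
        = (\<integral>\<^sup>+ \<omega>'. ennreal (exp (s * h (max 0 (a + ?S \<omega> + X 1 \<omega>')))) \<partial>M)"
        by this measurable
    qed
    also have "\<dots> \<le> (\<integral>\<^sup>+ \<omega>. (ennreal (exp (s * h (max 0 (a + ?S \<omega> + c)))) + ennreal C) \<partial>M)"
      by (intro nn_integral_mono step)
    also have "\<dots> = (\<integral>\<^sup>+ \<omega>. ennreal (exp (s * h (max 0 ((a + c) + ?S \<omega>)))) \<partial>M) + ennreal C"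
    proof -
      have eq: "a + ?S \<omega> + c = (a + c) + ?S \<omega>" for \<omega> by simp
      show ?thesis
        by (subst nn_integral_add) (simp_all add: eq emeasure_space_1 del: One_nat_def)
    qed
    also have "\<dots> \<le> ennreal (exp (s * h ((a + c) + real n * c)) + real n * C) + ennreal C"
      using Suc mean by (intro add_right_mono Suc.IH) auto
    also have "\<dots> = ennreal (exp (s * h (a + real (Suc n) * c)) + real (Suc n) * C)"
      using C by (simp add: ennreal_plus[symmetric] algebra_simps del: ennreal_plus)
    finally show ?case .
  qed
  with C show thesis by (rule that)
qed

lemma (in prob_space) indep_var_partial_sum:
  fixes X :: "nat \<Rightarrow> 'a \<Rightarrow> real"
  assumes "indep_vars (\<lambda>_. borel) X {1..}"
  shows "indep_var borel (\<lambda>\<omega>. \<Sum>k\<in>{1..n}. X k \<omega>) borel (X (Suc n))"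
proof -
  have "indep_var borel ((\<lambda>f. \<Sum>k\<in>{1..n}. f k) \<circ> (\<lambda>\<omega>. restrict (\<lambda>i. X i \<omega>) {1..n}))
      borel ((\<lambda>f. f (Suc n)) \<circ> (\<lambda>\<omega>. restrict (\<lambda>i. X i \<omega>) {Suc n}))"
    by (intro indep_var_compose[OF indep_var_restrict[OF assms]]) auto
  also have "((\<lambda>f. \<Sum>k\<in>{1..n}. f k) \<circ> (\<lambda>\<omega>. restrict (\<lambda>i. X i \<omega>) {1..n})) = (\<lambda>\<omega>. \<Sum>k\<in>{1..n}. X k \<omega>)"
    by (auto intro!: sum.cong)
  also have "((\<lambda>f. f (Suc n)) \<circ> (\<lambda>\<omega>. restrict (\<lambda>i. X i \<omega>) {Suc n})) = X (Suc n)"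
    by auto
  finally show ?thesis .
qed

section \<open>Tails, hazard functions and natural scales\<close>

text \<open>A variable bounded above almost surely has finite exponential moments. Positivity of the
  tail keeps the logarithm in \<open>hazard\<close> away from 0.\<close>

lemma heavy_tailed_prob_pos:
  assumes "prob_space M" and [measurable]: "Y \<in> borel_measurable M" and heavy: "heavy_tailed M Y"
  shows "0 < measure M {\<omega> \<in> space M. x < Y \<omega>}"
proof (rule ccontr)
  interpret prob_space M by fact
  assume "\<not> ?thesis"
  then have "prob {\<omega> \<in> space M. x < Y \<omega>} = 0" by (simp add: zero_less_measure_iff)
  then have "AE \<omega> in M. \<not> x < Y \<omega>"
    by (subst AE_iff_measurable[OF _ refl]) (auto simp: emeasure_eq_measure)
  then have "(\<integral>\<^sup>+ \<omega>. ennreal (exp (1 * Y \<omega>)) \<partial>M) \<le> (\<integral>\<^sup>+ \<omega>. ennreal (exp x) \<partial>M)"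
    by (intro nn_integral_mono_AE) (auto elim!: eventually_mono intro!: ennreal_leI)
  also have "\<dots> < \<infinity>" by (simp add: emeasure_space_1)
  finally have "(\<integral>\<^sup>+ \<omega>. ennreal (exp (1 * Y \<omega>)) \<partial>M) \<noteq> \<infinity>" by simp
  then show False using heavy zero_less_one unfolding heavy_tailed_def by blast
qed

text \<open>Where the tail vanishes, \<open>hazard\<close> takes the junk value \<open>- ln 0 = 0\<close> and the bound is
  trivial.\<close>

lemma tail_le_exp_hazard:
  assumes "a \<le> hazard M Y x"
  shows "measure M {\<omega> \<in> space M. x < Y \<omega>} \<le> exp (- a)"
proof (cases "measure M {\<omega> \<in> space M. x < Y \<omega>} = 0")
  case False
  then have "0 < measure M {\<omega> \<in> space M. x < Y \<omega>}" by (simp add: zero_less_measure_iff)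
  moreover have "exp (ln (measure M {\<omega> \<in> space M. x < Y \<omega>})) \<le> exp (- a)"
    using assms by (simp add: hazard_def)
  ultimately show ?thesis by simp
qed simp

lemma natural_scale_imp_concave_scale: "natural_scale M Y h \<Longrightarrow> concave_scale h"
  by (auto simp: natural_scale_def concave_scale_def)

context concave_scale
begin

text \<open>As \<open>h\<close> tends to infinity, \<open>ln D\<close> is eventually at most
  \<open>(s - r) * h x\<close>, so the constant \<open>D\<close> costs only the passage from
  \<open>s\<close> to \<open>r\<close>.\<close>

lemma Liminf_ratio_hazard_ge:
  assumes pos: "\<And>x. 0 < measure M {\<omega> \<in> space M. x < Y \<omega>}" and "0 < D" "r < s"
    and tail: "\<forall>\<^sub>F x in at_top. measure M {\<omega> \<in> space M. x < Y \<omega>} \<le> D * exp (- (s * h x))"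
  shows "ereal r \<le> Liminf at_top (\<lambda>x. ereal (hazard M Y x / h x))"
proof (rule Liminf_bounded)
  show "\<forall>\<^sub>F x in at_top. ereal r \<le> ereal (hazard M Y x / h x)"
    using tail eventually_ge[of 1] eventually_ge[of "ln D / (s - r)"]
  proof eventually_elim
    case (elim x)
    have "ln (measure M {\<omega> \<in> space M. x < Y \<omega>}) \<le> ln (D * exp (- (s * h x)))"
      using elim pos[of x] assms by (subst ln_le_cancel_iff) auto
    also have "\<dots> = ln D - s * h x" using assms by (simp add: ln_mult)
    also have "ln D \<le> (s - r) * h x" using elim assms by (simp add: field_simps)
    finally show ?case using elim by (simp add: hazard_def field_simps)
  qed
qed

text \<open>The loss is split evenly: one factor \<open>sqrt s\<close> for comparing
  \<open>g\<close> with \<open>h\<close>, the other for comparing the hazard with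
  \<open>g\<close>.\<close>

lemma natural_scale_tail:
  assumes g: "natural_scale M Y g" and dom: "1 \<le> Liminf at_top (\<lambda>x. ereal (g x / h x))"
    and s: "0 < s" "s < 1"
  shows "\<forall>\<^sub>F x in at_top. measure M {\<omega> \<in> space M. x < Y \<omega>} \<le> exp (- (s * h x))"
proof -
  interpret g: concave_scale g using g by (rule natural_scale_imp_concave_scale)
  have sqrt: "ereal (sqrt s) < 1" using s by simp
  have "\<forall>\<^sub>F x in at_top. ereal (sqrt s) < ereal (g x / h x)"
    using dom sqrt unfolding le_Liminf_iff by blast
  moreover have "\<forall>\<^sub>F x in at_top. ereal (sqrt s) < ereal (hazard M Y x / g x)"
  proof -
    have "1 \<le> Liminf at_top (\<lambda>x. ereal (hazard M Y x / g x))"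
      using g by (simp add: natural_scale_def)
    then show ?thesis using sqrt unfolding le_Liminf_iff by blast
  qed
  ultimately show ?thesis
    using eventually_ge[of 1] g.eventually_ge[of 1]
  proof eventually_elim
    case (elim x)
    have "s * h x = sqrt s * (sqrt s * h x)"
      using s by (simp add: mult.assoc[symmetric])
    also have "\<dots> \<le> sqrt s * g x"
      using elim s by (intro mult_left_mono) (auto simp: field_simps)
    also have "\<dots> \<le> hazard M Y x"
      using elim by (auto simp: field_simps)
    finally show ?case by (rule tail_le_exp_hazard)
  qed
qed

lemma natural_scale_self_tail:
  assumes "natural_scale M Y h" "0 < s" "s < 1"
  shows "\<forall>\<^sub>F x in at_top. measure M {\<omega> \<in> space M. x < Y \<omega>} \<le> exp (- (s * h x))"
proof (rule natural_scale_tail[OF assms(1) _ assms(2,3)])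
  show "1 \<le> Liminf at_top (\<lambda>x. ereal (h x / h x))"
    by (rule Liminf_bounded, use eventually_ge[of 1] in eventually_elim) (auto simp: one_ereal_def)
qed

text \<open>If \<open>h\<close> were above a line at arbitrarily large points, then by concavity it would be
  above that line everywhere, and \<open>Y\<close> would have an exponential moment.\<close>

lemma sublinear:
  assumes "prob_space M" and Y [measurable]: "Y \<in> borel_measurable M"
    and scale: "natural_scale M Y h" and "0 < a"
  shows "\<forall>\<^sub>F x in at_top. h x \<le> a * x"
proof (rule ccontr)
  assume not: "\<not> ?thesis"
  have above: "a * y \<le> h y" if "0 \<le> y" for y
  proof -
    have "\<exists>\<^sub>F x in at_top. \<not> h x \<le> a * x" using not by (simp add: not_eventually)
    then have "\<exists>\<^sub>F x in at_top. \<not> h x \<le> a * x \<and> y + 1 \<le> x"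
      using eventually_ge_at_top by (rule frequently_eventually_frequently)
    then have "\<exists>x. \<not> h x \<le> a * x \<and> y + 1 \<le> x" by (rule frequently_ex)
    then obtain x where x: "a * x < h x" "y + 1 \<le> x" by (meson not_le)
    show ?thesis
    proof (cases "y = 0")
      case False
      have "a * y = y / x * (a * x)" using x that by simp
      also have "\<dots> \<le> y / x * h x" using x that by (intro mult_left_mono) auto
      also have "\<dots> \<le> h (y / x * x)" using x that False by (intro scale_ge) auto
      finally show ?thesis using x that by simp
    qed (simp add: zero)
  qed
  have "(\<integral>\<^sup>+ \<omega>. ennreal (exp (1 / 2 * a * Y \<omega>)) \<partial>M)
      \<le> (\<integral>\<^sup>+ \<omega>. ennreal (exp (1 / 2 * h (max 0 (Y \<omega>)))) \<partial>M)"
  proof (intro nn_integral_mono ennreal_leI)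
    fix \<omega>
    have "a * Y \<omega> \<le> a * max 0 (Y \<omega>)" using \<open>0 < a\<close> by (intro mult_left_mono) auto
    also have "\<dots> \<le> h (max 0 (Y \<omega>))" by (rule above) simp
    finally show "exp (1 / 2 * a * Y \<omega>) \<le> exp (1 / 2 * h (max 0 (Y \<omega>)))" by simp
  qed
  also have "\<dots> < \<infinity>"
    \<comment> \<open>The tail exponent \<open>3 / 4\<close> is chosen strictly between the moment
      exponent \<open>1 / 2\<close> and 1.\<close>
    by (rule nn_integral_exp_finite[OF \<open>prob_space M\<close> Y natural_scale_self_tail[OF scale, of "3 / 4"]]) auto
  finally have "(\<integral>\<^sup>+ \<omega>. ennreal (exp (1 / 2 * a * Y \<omega>)) \<partial>M) < \<infinity>" .
  moreover have "0 < 1 / 2 * a" using \<open>0 < a\<close> by simp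
  then have "(\<integral>\<^sup>+ \<omega>. ennreal (exp (1 / 2 * a * Y \<omega>)) \<partial>M) = \<infinity>"
    using scale unfolding natural_scale_def heavy_tailed_def by blast
  ultimately show False by simp
qed

text \<open>A finite moment of \<open>exp (t * Y)\<close> gives a tail \<open>O(exp (- t x))\<close>
  by Markov's inequality. As \<open>h x \<le> t / 3 * x\<close> eventually, this is
  \<open>O(exp (- 3 h x))\<close>, and the lower limit would be at least 2.\<close>

lemma heavy_tailed_of_Liminf:
  assumes "prob_space M" and [measurable]: "Y \<in> borel_measurable M"
    and pos: "\<And>x. 0 < measure M {\<omega> \<in> space M. x < Y \<omega>}"
    and sublinear: "\<And>a. 0 < a \<Longrightarrow> \<forall>\<^sub>F x in at_top. h x \<le> a * x"
    and liminf: "Liminf at_top (\<lambda>x. ereal (hazard M Y x / h x)) \<le> 1"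
  shows "heavy_tailed M Y"
  unfolding heavy_tailed_def
proof (intro allI impI, rule ccontr)
  interpret prob_space M by fact
  fix t :: real assume t: "0 < t" and not: "(\<integral>\<^sup>+ \<omega>. ennreal (exp (t * Y \<omega>)) \<partial>M) \<noteq> \<infinity>"
  define B where "B = enn2real (\<integral>\<^sup>+ \<omega>. ennreal (exp (t * Y \<omega>)) \<partial>M)"
  have B: "(\<integral>\<^sup>+ \<omega>. ennreal (exp (t * Y \<omega>)) \<partial>M) = ennreal B" "0 \<le> B"
    using not by (simp_all add: B_def less_top)
  have chernoff: "prob {\<omega> \<in> space M. x < Y \<omega>} \<le> B * exp (- (t * x))" for x
  proof -
    have "ennreal (exp (t * x) * prob {\<omega> \<in> space M. x < Y \<omega>})
        = (\<integral>\<^sup>+ \<omega>. ennreal (exp (t * x)) * indicator {\<omega> \<in> space M. x < Y \<omega>} \<omega> \<partial>M)"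
      by (subst nn_integral_cmult_indicator) (auto simp: emeasure_eq_measure ennreal_mult)
    also have "\<dots> \<le> ennreal B"
      unfolding B(1)[symmetric] using t
      by (intro nn_integral_mono) (auto simp: indicator_def intro!: ennreal_leI)
    finally have "exp (t * x) * prob {\<omega> \<in> space M. x < Y \<omega>} \<le> B"
      using B by simp
    then show ?thesis by (simp add: exp_minus field_simps)
  qed
  have "\<forall>\<^sub>F x in at_top. h x \<le> t / 3 * x" using t by (intro sublinear) simp
  then have "\<forall>\<^sub>F x in at_top. prob {\<omega> \<in> space M. x < Y \<omega>} \<le> (B + 1) * exp (- (3 * h x))"
  proof eventually_elim
    case (elim x)
    note chernoff[of x]
    also have "B * exp (- (t * x)) \<le> (B + 1) * exp (- (3 * h x))"
      using elim B by (intro mult_mono) auto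
    finally show ?case .
  qed
  then have "ereal 2 \<le> Liminf at_top (\<lambda>x. ereal (hazard M Y x / h x))"
    using B by (intro Liminf_ratio_hazard_ge[where D = "B + 1" and s = 3] pos) auto
  also note liminf
  finally show False by simp
qed

end

section \<open>Tail bounds for the random sum, from above and from below\<close>

theorem theorem2p4:
  fixes M :: "'a measure" and X :: "nat \<Rightarrow> 'a \<Rightarrow> real" and N :: "'a \<Rightarrow> nat"
    and h :: "real \<Rightarrow> real" and \<delta> :: real
  assumes "prob_space M"
    and X_rv: "\<And>i. i \<ge> 1 \<Longrightarrow> X i \<in> borel_measurable M"
    and X_ident: "\<And>i. i \<ge> 1 \<Longrightarrow> distr M borel (X i) = distr M borel (X 1)"
    and X_heavy: "heavy_tailed M (X 1)"
    and X_int: "integrable M (X 1)"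
    and X_mean_pos: "prob_space.expectation M (X 1) > 0"
    and N_rv: "N \<in> measurable M (count_space UNIV)"
    and N_pos: "\<And>\<omega>. \<omega> \<in> space M \<Longrightarrow> N \<omega> \<ge> 1"
    and N_heavy: "heavy_tailed M (\<lambda>\<omega>. real (N \<omega>))"
    and indep: "prob_space.indep_vars M (\<lambda>_. borel)
                  (\<lambda>i. case i of None \<Rightarrow> (\<lambda>\<omega>. real (N \<omega>)) | Some k \<Rightarrow> X k)
                  (insert None (Some ` {1..}))"
    and delta_pos: "\<delta> > 0"
    and N_moment: "integrable M (\<lambda>\<omega>. real (N \<omega>) powr (1 + \<delta>))"
    and h_scale: "natural_scale M (\<lambda>\<omega>. prob_space.expectation M (X 1) * real (N \<omega>)) h"
    and h_log: "\<forall>\<^sub>F x in at_top. h x \<ge> (1 + \<delta>) * ln x"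
    and hX: "\<exists>hX. natural_scale M (X 1) hX \<and>
                  Liminf at_top (\<lambda>x. ereal (hX x / h x)) \<ge> 1"
  shows "natural_scale M (\<lambda>\<omega>. \<Sum>k\<in>{1..N \<omega>}. X k \<omega>) h"
proof -
  interpret prob_space M by fact
  interpret concave_scale h using h_scale by (rule natural_scale_imp_concave_scale)
  define m where "m = expectation (X 1)"
  define S where "S n \<omega> = (\<Sum>k\<in>{1..n}. X k \<omega>)" for n \<omega>
  define T where "T \<omega> = S (N \<omega>) \<omega>" for \<omega>
  have m: "0 < m" using X_mean_pos by (simp add: m_def)
  note N_rv[measurable]
  have X1 [measurable]: "X 1 \<in> borel_measurable M" by (rule X_rv) simp
  have S [measurable]: "S n \<in> borel_measurable M" for n
    unfolding S_def using X_rv by (intro borel_measurable_sum) auto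
  have T [measurable]: "T \<in> borel_measurable M"
    unfolding T_def by (rule measurable_compose_countable) measurable
  have scale: "natural_scale M (\<lambda>\<omega>. m * real (N \<omega>)) h"
    using h_scale by (simp add: m_def)
  have mN [measurable]: "(\<lambda>\<omega>. m * real (N \<omega>)) \<in> borel_measurable M" by measurable
  have indep_X: "indep_vars (\<lambda>_. borel) X {1..}"
  proof -
    have "indep_vars (\<lambda>_. borel) (\<lambda>i. case i of None \<Rightarrow> (\<lambda>\<omega>. real (N \<omega>)) | Some k \<Rightarrow> X k)
        (Some ` {1..})"
      using indep by (rule indep_vars_subset) auto
    from indep_vars_reindex[OF _ this] show ?thesis by simp
  qed
  have indep_N: "indep_var borel (\<lambda>\<omega>. real (N \<omega>)) borel (S n)" for n
  proof -
    define Y where "Y i = (case i of None \<Rightarrow> (\<lambda>\<omega>. real (N \<omega>)) | Some k \<Rightarrow> X k)" for i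
    have "indep_vars (\<lambda>_. borel) Y (insert None (Some ` {1..n}))"
      using indep unfolding Y_def by (rule indep_vars_subset) auto
    then have "indep_var borel (Y None) borel (\<lambda>\<omega>. \<Sum>i\<in>Some ` {1..n}. Y i \<omega>)"
      by (intro indep_vars_sum) auto
    moreover have "(\<lambda>\<omega>. \<Sum>i\<in>Some ` {1..n}. Y i \<omega>) = S n"
      by (simp add: fun_eq_iff sum.reindex S_def Y_def)
    moreover have "Y None = (\<lambda>\<omega>. real (N \<omega>))" by (simp add: Y_def)
    ultimately show ?thesis by simp
  qed
  have sublinear: "\<forall>\<^sub>F x in at_top. h x \<le> a * x" if "0 < a" for a
    by (rule sublinear[OF \<open>prob_space M\<close> mN scale that])
  have mN_pos: "0 < prob {\<omega> \<in> space M. x < m * real (N \<omega>)}" for x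
  proof (rule heavy_tailed_prob_pos[OF \<open>prob_space M\<close> mN])
    show "heavy_tailed M (\<lambda>\<omega>. m * real (N \<omega>))" using scale by (simp add: natural_scale_def)
  qed

  have upper: "\<exists>D>0. \<forall>x\<ge>0. prob {\<omega> \<in> space M. x < T \<omega>} \<le> D * exp (- (s * h x))"
    if s: "0 < s" "s < 1" "1 < s * (1 + \<delta>)" for s
  proof -
    \<comment> \<open>The factor \<gamma> inflates the mean to \<open>m * \<gamma>\<close>, giving
      strictly negative drift. Concavity turns \<open>s * h (n * m * \<gamma>)\<close> into at most
      \<open>\<theta> * h (m * n)\<close>, and \<open>\<theta> < 1\<close> keeps the moment over
      \<open>N\<close> finite.\<close>
    define \<theta> where "\<theta> = (s + 1) / 2"
    define \<gamma> where "\<gamma> = \<theta> / s"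
    have \<theta>: "0 < \<theta>" "\<theta> < 1" and \<gamma>: "1 < \<gamma>" "s * \<gamma> = \<theta>"
      using s by (simp_all add: \<theta>_def \<gamma>_def)
    obtain g where g: "natural_scale M (X 1) g" "1 \<le> Liminf at_top (\<lambda>x. ereal (g x / h x))"
      using hX by blast
    have fin_X: "(\<integral>\<^sup>+ \<omega>. ennreal (exp (s * h (max 0 (X 1 \<omega>)))) \<partial>M) < \<infinity>"
      by (rule nn_integral_exp_finite[OF \<open>prob_space M\<close> X1 natural_scale_tail[OF g, of "(s + 1) / 2"]])
        (use s in auto)
    have fin_N: "(\<integral>\<^sup>+ \<omega>. ennreal (exp (\<theta> * h (max 0 (m * real (N \<omega>))))) \<partial>M) < \<infinity>"
      by (rule nn_integral_exp_finite[OF \<open>prob_space M\<close> mN natural_scale_self_tail[OF scale, of "(\<theta> + 1) / 2"]])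
        (use \<theta> in auto)
    have c: "expectation (X 1) < m * \<gamma>" "0 \<le> m * \<gamma>"
      unfolding m_def[symmetric] using m \<gamma>(1) by simp_all
    obtain C where C: "0 \<le> C" "\<And>n a. 0 \<le> a \<Longrightarrow>
      (\<integral>\<^sup>+ \<omega>. ennreal (exp (s * h (max 0 (a + (\<Sum>k\<in>{1..n}. X k \<omega>))))) \<partial>M)
        \<le> ennreal (exp (s * h (a + real n * (m * \<gamma>))) + real n * C)"
      using random_walk_exp_moment[OF \<open>prob_space M\<close> X_int X_ident indep_var_partial_sum[OF indep_X]
          c s(1,3) h_log sublinear fin_X] by metis
    \<comment> \<open>The mean of \<open>N\<close> pays for the accumulated error
      \<open>real n * C\<close>; \<open>N \<ge> 1\<close> makes the moment of order
      \<open>1 + \<delta>\<close> dominate it.\<close>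
    have N_int: "integrable M (\<lambda>\<omega>. real (N \<omega>))"
    proof (rule Bochner_Integration.integrable_bound[OF N_moment])
      show "AE \<omega> in M. norm (real (N \<omega>)) \<le> norm (real (N \<omega>) powr (1 + \<delta>))"
      proof (rule AE_I2)
        fix \<omega> assume "\<omega> \<in> space M"
        then have "1 \<le> real (N \<omega>)" using N_pos by force
        then show "norm (real (N \<omega>)) \<le> norm (real (N \<omega>) powr (1 + \<delta>))"
          using powr_mono[of 1 "1 + \<delta>" "real (N \<omega>)"] delta_pos by simp
      qed
    qed measurable
    define A where "A = (\<integral>\<^sup>+ \<omega>. ennreal (exp (s * h (max 0 (T \<omega>)))) \<partial>M)"
    have "A = (\<integral>\<^sup>+ \<omega>. (\<integral>\<^sup>+ \<omega>'. ennreal (exp (s * h (max 0 (S (N \<omega>) \<omega>')))) \<partial>M) \<partial>M)"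
      unfolding A_def T_def
      by (rule nn_integral_random_index[OF N_rv indep_N, of "\<lambda>_ y. ennreal (exp (s * h (max 0 y)))"]) measurable
    also have "\<dots> \<le> (\<integral>\<^sup>+ \<omega>. (ennreal (exp (\<theta> * h (max 0 (m * real (N \<omega>))))) + ennreal (C * real (N \<omega>))) \<partial>M)"
    proof (rule nn_integral_mono)
      fix \<omega>
      let ?n = "real (N \<omega>)"
      have "h (?n * (m * \<gamma>)) \<le> \<gamma> * h (m * ?n)"
        using scale_le[of \<gamma> "m * ?n"] \<gamma> m by (simp add: mult_ac)
      then have "s * h (?n * (m * \<gamma>)) \<le> \<theta> * h (max 0 (m * ?n))"
        using s(1) m by (simp add: mult.assoc flip: \<gamma>(2))
      then have "exp (s * h (?n * (m * \<gamma>))) + ?n * C \<le> exp (\<theta> * h (max 0 (m * ?n))) + C * ?n"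
        by simp
      with C(2)[of 0 "N \<omega>"] show "(\<integral>\<^sup>+ \<omega>'. ennreal (exp (s * h (max 0 (S (N \<omega>) \<omega>')))) \<partial>M)
          \<le> ennreal (exp (\<theta> * h (max 0 (m * ?n)))) + ennreal (C * ?n)"
        using C(1) by (subst ennreal_plus[symmetric])
          (auto simp: S_def simp del: ennreal_plus intro: order_trans ennreal_leI)
    qed
    also have "\<dots> = (\<integral>\<^sup>+ \<omega>. ennreal (exp (\<theta> * h (max 0 (m * real (N \<omega>))))) \<partial>M)
        + (\<integral>\<^sup>+ \<omega>. ennreal (C * real (N \<omega>)) \<partial>M)"
      by (rule nn_integral_add) measurable
    also have "\<dots> < \<infinity>"
    proof -
      have "(\<integral>\<^sup>+ \<omega>. ennreal (C * real (N \<omega>)) \<partial>M) = ennreal (expectation (\<lambda>\<omega>. C * real (N \<omega>)))"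
        using N_int C by (intro nn_integral_eq_integral) auto
      then show ?thesis using fin_N by (simp add: ennreal_add_eq_top less_top)
    qed
    finally have A: "A < \<infinity>" .
    \<comment> \<open>Markov's inequality; adding 1 makes the constant strictly positive.\<close>
    have "prob {\<omega> \<in> space M. x < T \<omega>} \<le> (enn2real A + 1) * exp (- (s * h x))" if x: "0 \<le> x" for x
    proof -
      have "ennreal (exp (s * h x) * prob {\<omega> \<in> space M. x < T \<omega>})
          = (\<integral>\<^sup>+ \<omega>. ennreal (exp (s * h x)) * indicator {\<omega> \<in> space M. x < T \<omega>} \<omega> \<partial>M)"
        by (subst nn_integral_cmult_indicator) (auto simp: emeasure_eq_measure ennreal_mult)
      also have "\<dots> \<le> A"
        unfolding A_def using s x mono
        by (intro nn_integral_mono) (auto simp: indicator_def intro!: ennreal_leI)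
      also have "A = ennreal (enn2real A)" using A by simp
      finally have "exp (s * h x) * prob {\<omega> \<in> space M. x < T \<omega>} \<le> enn2real A + 1"
        by (simp add: add_increasing2)
      then show ?thesis by (simp add: exp_minus field_simps)
    qed
    then show ?thesis by (intro exI[of _ "enn2real A + 1"]) (simp add: add_nonneg_pos)
  qed

  have lower: "\<forall>\<^sub>F x in at_top. prob {\<omega> \<in> space M. x < m * real (N \<omega>)} \<le> 2 * prob {\<omega> \<in> space M. c * x < T \<omega>}"
    if c: "0 < c" "c < 1" for c
  proof -
    have cm: "c * m < expectation (X 1)" unfolding m_def[symmetric] using c m by simp
    have "\<forall>\<^sub>F n in sequentially. 1 / 2 \<le> prob {\<omega> \<in> space M. c * m * real n < S n \<omega>}"
      unfolding S_def by (rule eventually_prob_sum_gt[OF indep_X X_ident X_int cm])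
    then obtain n0 where n0: "\<And>n. n0 \<le> n \<Longrightarrow> 1 / 2 \<le> prob {\<omega> \<in> space M. c * m * real n < S n \<omega>}"
      unfolding eventually_sequentially by blast
    show ?thesis
      using eventually_ge_at_top[of "m * real n0"]
    proof eventually_elim
      case (elim x)
      \<comment> \<open>This is the indicator of \<open>x < m * n\<close> together with
        \<open>c * m * n < S n\<close>, which forces \<open>c * x < T\<close>. Given
        \<open>N = n\<close> with \<open>m * n > x\<close>, the choice of \<open>x\<close> ensures
        \<open>n \<ge> n0\<close>, so the second condition has probability at least
        \<open>1 / 2\<close>.\<close>
      define g :: "nat \<Rightarrow> real \<Rightarrow> ennreal" where
        "g n y = indicator {x<..} (m * real n) * indicator {c * m * real n<..} y" for n y
      have "ennreal (1 / 2 * prob {\<omega> \<in> space M. x < m * real (N \<omega>)})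
          = ennreal (1 / 2) * emeasure M {\<omega> \<in> space M. x < m * real (N \<omega>)}"
        unfolding emeasure_eq_measure by (rule ennreal_mult) auto
      also have "\<dots> = (\<integral>\<^sup>+ \<omega>. ennreal (1 / 2) * indicator {\<omega> \<in> space M. x < m * real (N \<omega>)} \<omega> \<partial>M)"
        by (rule nn_integral_cmult_indicator[symmetric]) measurable
      also have "\<dots> \<le> (\<integral>\<^sup>+ \<omega>. (\<integral>\<^sup>+ \<omega>'. g (N \<omega>) (S (N \<omega>) \<omega>') \<partial>M) \<partial>M)"
      proof (rule nn_integral_mono)
        fix \<omega> assume \<omega>: "\<omega> \<in> space M"
        show "ennreal (1 / 2) * indicator {\<omega> \<in> space M. x < m * real (N \<omega>)} \<omega>
            \<le> (\<integral>\<^sup>+ \<omega>'. g (N \<omega>) (S (N \<omega>) \<omega>') \<partial>M)"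
        proof (cases "x < m * real (N \<omega>)")
          case True
          then have "m * real n0 < m * real (N \<omega>)" using elim by linarith
          then have "n0 \<le> N \<omega>" using m by simp
          then have "ennreal (1 / 2) \<le> emeasure M {\<omega>' \<in> space M. c * m * real (N \<omega>) < S (N \<omega>) \<omega>'}"
            unfolding emeasure_eq_measure by (intro ennreal_leI n0)
          also have "\<dots> = (\<integral>\<^sup>+ \<omega>'. indicator {\<omega>' \<in> space M. c * m * real (N \<omega>) < S (N \<omega>) \<omega>'} \<omega>' \<partial>M)"
            by (rule nn_integral_indicator[symmetric]) measurable
          also have "\<dots> = (\<integral>\<^sup>+ \<omega>'. g (N \<omega>) (S (N \<omega>) \<omega>') \<partial>M)"
            using True by (intro nn_integral_cong) (auto simp: g_def indicator_def)
          finally show ?thesis using True \<omega> by simp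
        qed simp
      qed
      also have "\<dots> = (\<integral>\<^sup>+ \<omega>. g (N \<omega>) (S (N \<omega>) \<omega>) \<partial>M)"
        by (rule nn_integral_random_index[OF N_rv indep_N, symmetric]) (simp add: g_def)
      also have "\<dots> \<le> (\<integral>\<^sup>+ \<omega>. indicator {\<omega> \<in> space M. c * x < T \<omega>} \<omega> \<partial>M)"
      proof (rule nn_integral_mono)
        fix \<omega> assume \<omega>: "\<omega> \<in> space M"
        have "c * x < T \<omega>" if "x < m * real (N \<omega>)" "c * m * real (N \<omega>) < T \<omega>"
          using that mult_strict_left_mono[OF that(1) c(1)] by (simp add: mult.assoc)
        then show "g (N \<omega>) (S (N \<omega>) \<omega>) \<le> indicator {\<omega> \<in> space M. c * x < T \<omega>} \<omega>"
          using \<omega> by (auto simp: g_def T_def indicator_def)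
      qed
      also have "\<dots> = ennreal (prob {\<omega> \<in> space M. c * x < T \<omega>})"
        by (simp add: emeasure_eq_measure)
      finally show ?case by (simp add: ennreal_le_iff)
    qed
  qed

  have T_pos: "0 < prob {\<omega> \<in> space M. x < T \<omega>}" for x
  proof -
    have "\<forall>\<^sub>F y in at_top. prob {\<omega> \<in> space M. y < m * real (N \<omega>)} \<le> 2 * prob {\<omega> \<in> space M. 1 / 2 * y < T \<omega>}
        \<and> 2 * x \<le> y"
      by (intro eventually_conj lower eventually_ge_at_top) auto
    then obtain y where y: "prob {\<omega> \<in> space M. y < m * real (N \<omega>)} \<le> 2 * prob {\<omega> \<in> space M. 1 / 2 * y < T \<omega>}"
      "2 * x \<le> y"
      using eventually_happens trivial_limit_at_top_linorder by blast
    have "0 < prob {\<omega> \<in> space M. 1 / 2 * y < T \<omega>}"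
      using y(1) mN_pos[of y] by linarith
    also have "\<dots> \<le> prob {\<omega> \<in> space M. x < T \<omega>}"
      using y(2) by (intro finite_measure_mono) auto
    finally show ?thesis .
  qed
  have ge: "1 \<le> Liminf at_top (\<lambda>x. ereal (hazard M T x / h x))"
  proof (subst le_Liminf_iff, intro allI impI)
    fix y :: ereal assume "y < 1"
    then obtain r where r: "y < ereal r" "ereal r < 1"
      using ereal_dense2 by blast
    \<comment> \<open>A midpoint, so that \<open>s\<close> is below 1 but above both
      \<open>r\<close> and \<open>1 / (1 + \<delta>)\<close>; the latter is the condition
      \<open>1 < s * (1 + \<delta>)\<close> of \<open>upper\<close>.\<close>
    define s where "s = (1 + max r (1 / (1 + \<delta>))) / 2"
    have "1 / (1 + \<delta>) < s" "r < s" "s < 1"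
      using r delta_pos by (auto simp: s_def max_def field_simps)
    moreover from this have "1 < s * (1 + \<delta>)" "0 < s"
      using delta_pos by (auto simp: field_simps intro: less_trans[of 0 "1 / (1 + \<delta>)"])
    ultimately obtain D where D: "0 < D"
        "\<And>x. 0 \<le> x \<Longrightarrow> prob {\<omega> \<in> space M. x < T \<omega>} \<le> D * exp (- (s * h x))"
      using upper by blast
    have "\<forall>\<^sub>F x in at_top. prob {\<omega> \<in> space M. x < T \<omega>} \<le> D * exp (- (s * h x))"
      using eventually_ge_at_top[of 0] by eventually_elim (rule D)
    then have "ereal r \<le> Liminf at_top (\<lambda>x. ereal (hazard M T x / h x))"
      using D \<open>r < s\<close> by (intro Liminf_ratio_hazard_ge[where D = D and s = s] T_pos) auto
    with r(1) have "y < Liminf at_top (\<lambda>x. ereal (hazard M T x / h x))" by (rule less_le_trans)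
    then show "\<forall>\<^sub>F x in at_top. y < ereal (hazard M T x / h x)" by (rule less_LiminfD)
  qed
  have le: "Liminf at_top (\<lambda>x. ereal (hazard M T x / h x)) \<le> 1"
  proof (rule ccontr)
    assume "\<not> ?thesis"
    then obtain r where r: "1 < ereal r" "ereal r < Liminf at_top (\<lambda>x. ereal (hazard M T x / h x))"
      using ereal_dense2[of 1] by (auto simp: not_le)
    \<comment> \<open>The midpoint of \<open>1 / r\<close> and 1. Since
      \<open>h (c * x) \<ge> c * h x\<close>, a tail rate \<open>r\<close> for \<open>T\<close>
      would pass to the rate \<open>r * c > 1\<close> for \<open>m * N\<close>, contradicting that
      \<open>h\<close> is a natural scale of \<open>m * N\<close>.\<close>
    define c where "c = (1 + 1 / r) / 2"
    have c: "0 < c" "c < 1" "1 < r * c"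
      using r by (simp_all add: c_def field_simps)
    have "\<forall>\<^sub>F x in at_top. ereal r < ereal (hazard M T x / h x)"
      using r(2) by (rule less_LiminfD)
    then have "\<forall>\<^sub>F x in at_top. prob {\<omega> \<in> space M. x < T \<omega>} \<le> exp (- (r * h x))"
      using eventually_ge[of 1]
    proof eventually_elim
      case (elim x)
      then show ?case by (intro tail_le_exp_hazard) (simp add: field_simps)
    qed
    moreover have "filterlim (\<lambda>x. c * x) at_top at_top"
      using c by (intro filterlim_tendsto_pos_mult_at_top[OF tendsto_const]) (auto simp: filterlim_ident)
    ultimately have "\<forall>\<^sub>F x in at_top. prob {\<omega> \<in> space M. c * x < T \<omega>} \<le> exp (- (r * h (c * x)))"
      by (rule eventually_compose_filterlim)
    then have "\<forall>\<^sub>F x in at_top. prob {\<omega> \<in> space M. x < m * real (N \<omega>)} \<le> 2 * exp (- (r * c * h x))"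
      using lower[OF c(1,2)] eventually_ge_at_top[of 0]
    proof eventually_elim
      case (elim x)
      have "r * (c * h x) \<le> r * h (c * x)"
        using r c elim by (intro mult_left_mono scale_ge) auto
      then have "exp (- (r * h (c * x))) \<le> exp (- (r * c * h x))" by (simp add: mult.assoc)
      then show ?case using elim by linarith
    qed
    then have "ereal ((1 + r * c) / 2) \<le> Liminf at_top (\<lambda>x. ereal (hazard M (\<lambda>\<omega>. m * real (N \<omega>)) x / h x))"
      using c by (intro Liminf_ratio_hazard_ge[where D = 2 and s = "r * c"] mN_pos) (auto simp: mult.commute)
    also have "\<dots> = 1" using scale by (simp add: natural_scale_def)
    finally show False using c(3) by (simp add: one_ereal_def mult.commute)
  qed
  \<comment> \<open>Heaviness of the sum is read off from the upper bound on the lower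
    limit.\<close>
  have "heavy_tailed M T"
    using \<open>prob_space M\<close> T T_pos sublinear le by (rule heavy_tailed_of_Liminf)
  then have "natural_scale M T h"
    using concave zero nonneg lim ge le by (auto simp: natural_scale_def)
  then show ?thesis by (simp add: T_def[abs_def] S_def)
qed

end
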